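(* Let $\Omega\subseteq\mathbb{R}^d$ be locally compact Hausdorff and let $q_0\in C(\Omega)$ be a probability density such that $q_0(x)>0$ for all $x\in\Omega$. Let $\ell$ be a constant and let $\mathcal{P}_c$ be the set of all $p\in C(\Omega)$ such that $\int_\Omega p(x)\,dx=1$, $p(x)\ge 0$ for all $x\in\Omega$, $\frac{p}{q_0}-\ell\in C_0(\Omega)$, and for every $\epsilon>0$ there exists $R>0$ with $\left|\frac{p(x)}{q_0(x)}-\ell\right|\le\epsilon$ for all $x\in\Omega$ with $\|x\|_2>R$. Let $k$ be a reproducing kernel on $\Omega$ with RKHS $\mathcal{H}$ and associated family $\mathcal{P}$. Suppose $k(x,\cdot)\in C_0(\Omega)$ for all $x\in\Omega$ and $$\int\!\!\int k(x,y)\,d\mu(x)\,d\mu(y)>0\qquad\text{for all }\mu\in M_b(\Omega)\setminus\{0\}.$$ Then $\mathcal{P}$ is dense in $\mathcal{P}_c$ with respect to KL divergence, total variation and Hellinger distances. Moreover, if $q_0\in L^1(\Omega)\cap L^r(\Omega)$ for some $1<r\le\infty$, then $\mathcal{P}$ is also dense in $\mathcal{P}_c$ with respect to the $L^r$ norm.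
   Context: For a measurable function $f$ on $\Omega$, $A(f):=\log\int_\Omega e^{f(x)}q_0(x)\,dx$. $\mathcal{H}$ is the reproducing kernel Hilbert space (RKHS) of functions on $\Omega$ with reproducing kernel $k$ (real-valued, symmetric, positive definite); $\mathcal{F}:=\{f\in\mathcal{H}: e^{A(f)}<\infty\}$ and $\mathcal{P}:=\{p_f(x)=e^{f(x)-A(f)}q_0(x),\ x\in\Omega: f\in\mathcal{F}\}$. $C(\Omega)$ is the space of continuous functions on $\Omega$; $C_0(\Omega)$ is the space of continuous functions on $\Omega$ vanishing at infinity (i.e. $\{x:|f(x)|\ge\epsilon\}$ is compact for every $\epsilon>0$). $M_b(\Omega)$ is the set of all finite signed Borel measures on $\Omega$. For probability densities $p,q$ on $\Omega$: $KL(p\|q)=\int p\log\frac{p}{q}\,dx$, the Hellinger distance is $h(p,q)=\|\sqrt p-\sqrt q\|_{L^2(\Omega)}$, the total variation distance is $\|p-q\|_{L^1(\Omega)}$. "$\mathcal{P}$ is dense in $\mathcal{P}_c$ w.r.t. $D$" means: for every $p\in\mathcal{P}_c$ and $\epsilon>0$ there is $p'\in\mathcal{P}$ with $D(p,p')\le\epsilon$ (for KL: $KL(p\|p')\le\epsilon$). *)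

theory Defs
  imports "HOL-Probability.Probability" "HOL-Probability.Essential_Supremum"
begin

text \<open>
  A function on \<open>\<Omega>\<close> is represented by a total function. Only its values on \<open>\<Omega>\<close> are used, except that
  elements of a function space carrying a vector space structure are normalised to vanish
  outside \<open>\<Omega>\<close> (see \<open>is_rkhs\<close>). Lebesgue measure on \<open>\<Omega>\<close> is \<^term>\<open>lebesgue_on \<Omega>\<close>.
\<close>

definition C0 :: "'a::topological_space set \<Rightarrow> ('a \<Rightarrow> real) set" where
  "C0 \<Omega> = {f. continuous_on \<Omega> f \<and> (\<forall>\<epsilon>>0. compact {x \<in> \<Omega>. \<bar>f x\<bar> \<ge> \<epsilon>})}"


section \<open>Finite signed measures\<close>

text \<open>Real-valued, hence finite, countably additive set functions on the \<open>\<sigma>\<close>-algebra of \<open>M\<close>;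
  the measure carried by \<open>M\<close> itself plays no role.\<close>

definition signed_measure :: "'a measure \<Rightarrow> ('a set \<Rightarrow> real) \<Rightarrow> bool" where
  "signed_measure M \<mu> \<longleftrightarrow> \<mu> {} = 0 \<and>
     (\<forall>A :: nat \<Rightarrow> 'a set. range A \<subseteq> sets M \<longrightarrow> disjoint_family A \<longrightarrow>
        (\<lambda>i. \<mu> (A i)) sums \<mu> (\<Union>i. A i))"

text \<open>The positive part in the Jordan decomposition of \<open>\<mu>\<close>; the negative part is the positive part
  of \<open>- \<mu>\<close>.\<close>

definition pos_variation :: "'a measure \<Rightarrow> ('a set \<Rightarrow> real) \<Rightarrow> 'a measure" where
  "pos_variation M \<mu> =
     measure_of (space M) (sets M) (\<lambda>A. SUP B\<in>{B \<in> sets M. B \<subseteq> A}. ennreal (\<mu> B))"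

definition signed_integral :: "'a measure \<Rightarrow> ('a set \<Rightarrow> real) \<Rightarrow> ('a \<Rightarrow> real) \<Rightarrow> real" where
  "signed_integral M \<mu> f =
     (LINT x|pos_variation M \<mu>. f x) - (LINT x|pos_variation M (\<lambda>A. - \<mu> A). f x)"

text \<open>No integrability is required separately below: positivity for nonnegative measures already
  implies it for them, and for a kernel with \<open>k x \<in> C0 \<Omega>\<close> this forces \<open>k\<close> to be bounded.\<close>

definition integrally_strictly_pd :: "'a::topological_space set \<Rightarrow> ('a \<Rightarrow> 'a \<Rightarrow> real) \<Rightarrow> bool" where
  "integrally_strictly_pd \<Omega> k \<longleftrightarrow>
     (let B = restrict_space borel \<Omega> in
      \<forall>\<mu>. signed_measure B \<mu> \<longrightarrow> (\<exists>A\<in>sets B. \<mu> A \<noteq> 0) \<longrightarrow>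
        signed_integral B \<mu> (\<lambda>y. signed_integral B \<mu> (\<lambda>x. k x y)) > 0)"


section \<open>Reproducing kernel Hilbert spaces\<close>

definition pos_def_kernel :: "'a set \<Rightarrow> ('a \<Rightarrow> 'a \<Rightarrow> real) \<Rightarrow> bool" where
  "pos_def_kernel \<Omega> k \<longleftrightarrow>
     (\<forall>x\<in>\<Omega>. \<forall>y\<in>\<Omega>. k x y = k y x) \<and>
     (\<forall>X a. finite X \<longrightarrow> X \<subseteq> \<Omega> \<longrightarrow> (\<Sum>x\<in>X. \<Sum>y\<in>X. a x * a y * k x y) \<ge> 0)"

definition kernel_section :: "'a set \<Rightarrow> ('a \<Rightarrow> 'a \<Rightarrow> real) \<Rightarrow> 'a \<Rightarrow> 'a \<Rightarrow> real" where
  "kernel_section \<Omega> k x = (\<lambda>y. if y \<in> \<Omega> then k x y else 0)"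

text \<open>\<open>H\<close> with inner product \<open>ip\<close> is a real Hilbert space of functions on \<open>\<Omega>\<close>. Vanishing outside
  \<open>\<Omega>\<close> makes equality of elements of \<open>H\<close> the same as equality on \<open>\<Omega>\<close>.\<close>

definition hilbert_function_space ::
    "'a set \<Rightarrow> ('a \<Rightarrow> real) set \<Rightarrow> (('a \<Rightarrow> real) \<Rightarrow> ('a \<Rightarrow> real) \<Rightarrow> real) \<Rightarrow> bool" where
  "hilbert_function_space \<Omega> H ip \<longleftrightarrow>
     (\<forall>f\<in>H. \<forall>x. x \<notin> \<Omega> \<longrightarrow> f x = 0) \<and>
     (\<lambda>x. 0) \<in> H \<and>
     (\<forall>f\<in>H. \<forall>g\<in>H. (\<lambda>x. f x + g x) \<in> H) \<and>
     (\<forall>c. \<forall>f\<in>H. (\<lambda>x. c * f x) \<in> H) \<and>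
     (\<forall>f\<in>H. \<forall>g\<in>H. ip f g = ip g f) \<and>
     (\<forall>f\<in>H. \<forall>g\<in>H. \<forall>h\<in>H. ip (\<lambda>x. f x + g x) h = ip f h + ip g h) \<and>
     (\<forall>c. \<forall>f\<in>H. \<forall>g\<in>H. ip (\<lambda>x. c * f x) g = c * ip f g) \<and>
     (\<forall>f\<in>H. ip f f \<ge> 0) \<and>
     (\<forall>f\<in>H. ip f f = 0 \<longrightarrow> f = (\<lambda>x. 0)) \<and>
     (let dst = (\<lambda>f g. sqrt (ip (\<lambda>x. f x - g x) (\<lambda>x. f x - g x))) in
      \<forall>u :: nat \<Rightarrow> 'a \<Rightarrow> real. (\<forall>n. u n \<in> H) \<longrightarrow>
        (\<forall>\<epsilon>>0. \<exists>N. \<forall>m\<ge>N. \<forall>n\<ge>N. dst (u m) (u n) < \<epsilon>) \<longrightarrow>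
        (\<exists>f\<in>H. (\<lambda>n. dst (u n) f) \<longlonglongrightarrow> 0))"

definition is_rkhs ::
    "'a set \<Rightarrow> ('a \<Rightarrow> 'a \<Rightarrow> real) \<Rightarrow> ('a \<Rightarrow> real) set \<Rightarrow> (('a \<Rightarrow> real) \<Rightarrow> ('a \<Rightarrow> real) \<Rightarrow> real) \<Rightarrow> bool"
  where
  "is_rkhs \<Omega> k H ip \<longleftrightarrow>
     hilbert_function_space \<Omega> H ip \<and>
     (\<forall>x\<in>\<Omega>. kernel_section \<Omega> k x \<in> H) \<and>
     (\<forall>f\<in>H. \<forall>x\<in>\<Omega>. f x = ip f (kernel_section \<Omega> k x))"


section \<open>The exponential family and the target class\<close>

definition log_partition :: "'a::euclidean_space set \<Rightarrow> ('a \<Rightarrow> real) \<Rightarrow> ('a \<Rightarrow> real) \<Rightarrow> real" where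
  "log_partition \<Omega> q0 f = ln (LINT x|lebesgue_on \<Omega>. exp (f x) * q0 x)"

text \<open>The condition \<open>exp (A f) < \<infinity>\<close> is integrability of the nonnegative function \<open>exp f * q0\<close>;
  \<^term>\<open>log_partition\<close> is only meaningful for such \<open>f\<close>.\<close>

definition natural_params ::
    "'a::euclidean_space set \<Rightarrow> ('a \<Rightarrow> real) \<Rightarrow> ('a \<Rightarrow> real) set \<Rightarrow> ('a \<Rightarrow> real) set" where
  "natural_params \<Omega> q0 H = {f \<in> H. integrable (lebesgue_on \<Omega>) (\<lambda>x. exp (f x) * q0 x)}"

definition exp_family ::
    "'a::euclidean_space set \<Rightarrow> ('a \<Rightarrow> real) \<Rightarrow> ('a \<Rightarrow> real) set \<Rightarrow> ('a \<Rightarrow> real) set" where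
  "exp_family \<Omega> q0 H =
     (\<lambda>f x. exp (f x - log_partition \<Omega> q0 f) * q0 x) ` natural_params \<Omega> q0 H"

definition target_class ::
    "'a::euclidean_space set \<Rightarrow> ('a \<Rightarrow> real) \<Rightarrow> real \<Rightarrow> ('a \<Rightarrow> real) set" where
  "target_class \<Omega> q0 l = {p.
     continuous_on \<Omega> p \<and>
     integrable (lebesgue_on \<Omega>) p \<and> (LINT x|lebesgue_on \<Omega>. p x) = 1 \<and>
     (\<forall>x\<in>\<Omega>. p x \<ge> 0) \<and>
     (\<lambda>x. p x / q0 x - l) \<in> C0 \<Omega> \<and>
     (\<forall>\<epsilon>>0. \<exists>R>0. \<forall>x\<in>\<Omega>. norm x > R \<longrightarrow> \<bar>p x / q0 x - l\<bar> \<le> \<epsilon>)}"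


section \<open>Divergences\<close>

text \<open>All values are extended reals, so that a divergent integral is \<open>\<infinity>\<close>.\<close>

definition Lr_norm :: "'a::euclidean_space set \<Rightarrow> ereal \<Rightarrow> ('a \<Rightarrow> real) \<Rightarrow> ereal" where
  "Lr_norm \<Omega> r f =
     (if r = \<infinity> then enn2ereal (esssup (lebesgue_on \<Omega>) (\<lambda>x. ennreal \<bar>f x\<bar>))
      else if integrable (lebesgue_on \<Omega>) (\<lambda>x. \<bar>f x\<bar> powr real_of_ereal r)
      then ereal ((LINT x|lebesgue_on \<Omega>. \<bar>f x\<bar> powr real_of_ereal r) powr (1 / real_of_ereal r))
      else \<infinity>)"

definition Lr_space :: "'a::euclidean_space set \<Rightarrow> ereal \<Rightarrow> ('a \<Rightarrow> real) set" where
  "Lr_space \<Omega> r = {f \<in> borel_measurable (lebesgue_on \<Omega>). Lr_norm \<Omega> r f < \<infinity>}"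

definition Lr_dist :: "'a::euclidean_space set \<Rightarrow> ereal \<Rightarrow> ('a \<Rightarrow> real) \<Rightarrow> ('a \<Rightarrow> real) \<Rightarrow> ereal" where
  "Lr_dist \<Omega> r p q = Lr_norm \<Omega> r (\<lambda>x. p x - q x)"

definition tv_dist :: "'a::euclidean_space set \<Rightarrow> ('a \<Rightarrow> real) \<Rightarrow> ('a \<Rightarrow> real) \<Rightarrow> ereal" where
  "tv_dist \<Omega> p q = Lr_norm \<Omega> 1 (\<lambda>x. p x - q x)"

definition hellinger_dist :: "'a::euclidean_space set \<Rightarrow> ('a \<Rightarrow> real) \<Rightarrow> ('a \<Rightarrow> real) \<Rightarrow> ereal" where
  "hellinger_dist \<Omega> p q = Lr_norm \<Omega> 2 (\<lambda>x. sqrt (p x) - sqrt (q x))"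

text \<open>For probability densities the negative part of \<open>p log (p / q)\<close> is integrable whenever
  \<open>p = 0\<close> almost everywhere on \<open>{q = 0}\<close>, so failure of integrability means the value \<open>\<infinity>\<close>.
  The convention \<open>0 log 0 = 0\<close> holds because of \<open>0 * y = 0\<close>.\<close>

definition KL_div :: "'a::euclidean_space set \<Rightarrow> ('a \<Rightarrow> real) \<Rightarrow> ('a \<Rightarrow> real) \<Rightarrow> ereal" where
  "KL_div \<Omega> p q =
     (if (AE x in lebesgue_on \<Omega>. q x = 0 \<longrightarrow> p x = 0) \<and>
         integrable (lebesgue_on \<Omega>) (\<lambda>x. p x * ln (p x / q x))
      then ereal (LINT x|lebesgue_on \<Omega>. p x * ln (p x / q x))
      else \<infinity>)"

definition dense_wrt :: "('b \<Rightarrow> 'b \<Rightarrow> ereal) \<Rightarrow> 'b set \<Rightarrow> 'b set \<Rightarrow> bool" where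
  "dense_wrt D P Q \<longleftrightarrow> (\<forall>p\<in>Q. \<forall>\<epsilon>::real. \<epsilon> > 0 \<longrightarrow> (\<exists>p'\<in>P. D p p' \<le> ereal \<epsilon>))"

end

theory Submission
  imports Defs
begin

text \<open>
  Write \<open>p\<^sub>\<tau> = (p + \<tau> q\<^sub>0) / (1 + \<tau>)\<close> for a target density \<open>p\<close> and small \<open>\<tau> > 0\<close>. Since \<open>p / q\<^sub>0\<close> tends to
  \<open>l\<close> at infinity and \<open>p\<^sub>\<tau> / q\<^sub>0\<close> is bounded away from \<open>0\<close>, the function \<open>log (p\<^sub>\<tau> / q\<^sub>0)\<close> is a constant
  plus some \<open>g \<in> C\<^sub>0(\<Omega>)\<close>. If \<open>h \<in> H\<close> satisfies \<open>\<bar>g - h\<bar> \<le> \<eta>\<close> on \<open>\<Omega>\<close>, then \<open>exp h q\<^sub>0\<close> and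
  \<open>exp g q\<^sub>0\<close> agree up to a factor in \<open>[exp (-\<eta>), exp \<eta>]\<close>, hence so do their integrals, and the member
  \<open>q\<close> of the exponential family with parameter \<open>h\<close> agrees with \<open>p\<^sub>\<tau>\<close> up to a factor in
  \<open>[exp (-2\<eta>), exp (2\<eta>)]\<close>; the unknown constants cancel in the normalisation. Choosing \<open>\<tau>\<close> and \<open>\<eta>\<close>
  small gives the two pointwise bounds \<open>\<bar>p - q\<bar> \<le> \<theta> q\<^sub>0\<close> and \<open>log (p / q) \<le> \<theta>\<close> of
  \<open>exp_family_uniform_approximation\<close>. The second one integrates to a bound on the KL divergence, the
  first one to bounds on all the norms.

  What remains is that functions in \<open>H\<close> approximate every \<open>g \<in> C\<^sub>0(\<Omega>)\<close> uniformly
  (\<open>rkhs_dense_in_C0\<close>). This is duality: if \<open>V = H \<inter> C\<^sub>0(\<Omega>)\<close> were not dense, some nonzero finite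
  signed measure \<open>\<mu>\<close> would annihilate \<open>V\<close>. As \<open>V\<close> contains the kernel sections, \<open>\<integral> k(x,y) d\<mu>(x) = 0\<close>
  for every \<open>y\<close>, so the double integral of \<open>k\<close> against \<open>\<mu>\<close> vanishes, which strict positive
  definiteness forbids.

  The measure \<open>\<mu>\<close> is obtained as follows (\<open>C0_dense_if_no_annihilator\<close>). The Hahn-Banach theorem
  is applied to pairs of \<open>C\<^sub>0\<close> functions, with a sublinear functional arranged so that the two
  components of the resulting functional are positive, agree on \<open>V\<close> and differ at \<open>g\<close>; a Jordan
  decomposition of functionals is thereby avoided. The Riesz representation theorem turns both
  components into finite measures, and \<open>\<mu>\<close> is their difference. Finally
  \<open>signed_integral_measure_diff\<close> says that integrating against the Jordan decomposition of \<open>\<mu>\<close> is the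
  same as subtracting the integrals against the two measures.
\<close>


section \<open>The Hahn-Banach theorem on spaces of real functions\<close>

definition function_subspace :: "('b \<Rightarrow> real) set \<Rightarrow> bool" where
  "function_subspace E \<longleftrightarrow>
     (\<lambda>x. 0) \<in> E \<and>
     (\<forall>F\<in>E. \<forall>G\<in>E. (\<lambda>x. F x + G x) \<in> E) \<and>
     (\<forall>c. \<forall>F\<in>E. (\<lambda>x. c * F x) \<in> E)"

lemma function_subspaceD:
  assumes "function_subspace E"
  shows "(\<lambda>x. 0) \<in> E"
    and "F \<in> E \<Longrightarrow> G \<in> E \<Longrightarrow> (\<lambda>x. F x + G x) \<in> E"
    and "F \<in> E \<Longrightarrow> (\<lambda>x. c * F x) \<in> E"
    and "F \<in> E \<Longrightarrow> (\<lambda>x. - F x) \<in> E"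
    and "F \<in> E \<Longrightarrow> G \<in> E \<Longrightarrow> (\<lambda>x. F x - G x) \<in> E"
proof -
  show 1: "(\<lambda>x. 0) \<in> E" and 2: "F \<in> E \<Longrightarrow> G \<in> E \<Longrightarrow> (\<lambda>x. F x + G x) \<in> E"
    and 3: "F \<in> E \<Longrightarrow> (\<lambda>x. c * F x) \<in> E" for F G c
    using assms by (auto simp: function_subspace_def)
  show 4: "F \<in> E \<Longrightarrow> (\<lambda>x. - F x) \<in> E" for F
    using 3[of F "-1"] by simp
  show "F \<in> E \<Longrightarrow> G \<in> E \<Longrightarrow> (\<lambda>x. F x - G x) \<in> E"
    using 2[of F "\<lambda>x. - G x"] 4[of G] by simp
qed

definition sublinear_on :: "('b \<Rightarrow> real) set \<Rightarrow> (('b \<Rightarrow> real) \<Rightarrow> real) \<Rightarrow> bool" where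
  "sublinear_on E q \<longleftrightarrow>
     (\<forall>F\<in>E. \<forall>G\<in>E. q (\<lambda>x. F x + G x) \<le> q F + q G) \<and>
     (\<forall>c>0. \<forall>F\<in>E. q (\<lambda>x. c * F x) \<le> c * q F)"

definition linear_functional_on :: "('b \<Rightarrow> real) set \<Rightarrow> (('b \<Rightarrow> real) \<Rightarrow> real) \<Rightarrow> bool" where
  "linear_functional_on E L \<longleftrightarrow>
     (\<forall>F\<in>E. \<forall>G\<in>E. L (\<lambda>x. F x + G x) = L F + L G) \<and>
     (\<forall>c. \<forall>F\<in>E. L (\<lambda>x. c * F x) = c * L F)"

lemma sublinear_onD:
  assumes "sublinear_on E q" "function_subspace E"
  shows "F \<in> E \<Longrightarrow> G \<in> E \<Longrightarrow> q (\<lambda>x. F x + G x) \<le> q F + q G"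
    and "F \<in> E \<Longrightarrow> 0 \<le> c \<Longrightarrow> q (\<lambda>x. c * F x) = c * q F"
    and "F \<in> E \<Longrightarrow> - q (\<lambda>x. - F x) \<le> q F"
    and "q (\<lambda>x. 0) = 0"
proof -
  note E = function_subspaceD[OF assms(2)]
  show add: "q (\<lambda>x. F x + G x) \<le> q F + q G" if "F \<in> E" "G \<in> E" for F G
    using assms that by (auto simp: sublinear_on_def)
  have le: "q (\<lambda>x. c * F x) \<le> c * q F" if "F \<in> E" "0 < c" for F c
    using assms that by (auto simp: sublinear_on_def)
  have hom: "q (\<lambda>x. c * F x) = c * q F" if F: "F \<in> E" and c: "0 < c" for F c
  proof -
    have "q (\<lambda>x. inverse c * (c * F x)) \<le> inverse c * q (\<lambda>x. c * F x)"
      using E(3)[OF F] c by (intro le) auto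
    moreover have "(\<lambda>x. inverse c * (c * F x)) = F"
      using c by (auto simp: field_simps)
    ultimately have "c * q F \<le> q (\<lambda>x. c * F x)"
      using c by (simp add: field_simps)
    then show ?thesis using le[OF that] by simp
  qed
  show zero: "q (\<lambda>x. 0) = 0"
    using hom[OF E(1), of 2] by simp
  show "q (\<lambda>x. c * F x) = c * q F" if "F \<in> E" "0 \<le> c" for F c
    using that hom[of F c] zero by (cases "c = 0") auto
  show "- q (\<lambda>x. - F x) \<le> q F" if "F \<in> E"
    using add[OF that E(4)[OF that]] zero by simp
qed

text \<open>
  The functional \<open>r F = inf {q (F + t G) - t q G | t \<ge> 0}\<close> is sublinear and lies below \<open>q\<close>, and the
  term with \<open>t = 1\<close> makes \<open>q\<close> superadditive in the direction \<open>G\<close> wherever \<open>r = q\<close>. This one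
  construction both forces the value at \<open>G\<close> in the Hahn-Banach theorem (take \<open>F = - G\<close>) and shows that
  minimal sublinear functionals are linear. Values outside \<open>E\<close> are fixed to \<open>0\<close> so that minimality is
  about equality of total functions.
\<close>

lemma sublinear_on_linearize_direction:
  assumes E: "function_subspace E" and q: "sublinear_on E q" and G: "G \<in> E"
  obtains r where "sublinear_on E r" "\<And>F. F \<in> E \<Longrightarrow> r F \<le> q F"
    "\<And>F. F \<in> E \<Longrightarrow> r F \<le> q (\<lambda>x. F x + G x) - q G" "\<And>F. F \<notin> E \<Longrightarrow> r F = 0"
proof
  note E' = function_subspaceD[OF E]
  note q' = sublinear_onD[OF q E]
  define h where "h F t = q (\<lambda>x. F x + t * G x) - t * q G" for F t
  define r where "r F = (if F \<in> E then INF t\<in>{0..}. h F t else 0)" for F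
  have low: "- q (\<lambda>x. - F x) \<le> h F t" if "F \<in> E" "0 \<le> t" for F t
  proof -
    have "q (\<lambda>x. (F x + t * G x) + - F x) \<le> q (\<lambda>x. F x + t * G x) + q (\<lambda>x. - F x)"
      using that E' G by (intro q'(1)) auto
    then show ?thesis using q'(2)[OF G that(2)] by (simp add: h_def)
  qed
  have bdd: "bdd_below (h F ` {0..})" if "F \<in> E" for F
    using low[OF that] by (intro bdd_belowI2[where m = "- q (\<lambda>x. - F x)"]) auto
  have up: "r F \<le> h F t" if "F \<in> E" "0 \<le> t" for F t
    using cINF_lower[OF bdd, of F t] that by (simp add: r_def)
  have great: "m \<le> r F" if "F \<in> E" "\<And>t. 0 \<le> t \<Longrightarrow> m \<le> h F t" for F m
    using that by (auto simp: r_def intro!: cINF_greatest)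
  show "r F \<le> q F" if "F \<in> E" for F
    using up[OF that, of 0] by (simp add: h_def)
  show "r F \<le> q (\<lambda>x. F x + G x) - q G" if "F \<in> E" for F
    using up[OF that, of 1] by (simp add: h_def)
  show "r F = 0" if "F \<notin> E" for F
    using that by (simp add: r_def)
  show "sublinear_on E r"
    unfolding sublinear_on_def
  proof (intro conjI ballI allI impI)
    fix F F' assume F: "F \<in> E" "F' \<in> E"
    have *: "r (\<lambda>x. F x + F' x) \<le> h F s + h F' t" if "0 \<le> s" "0 \<le> t" for s t
    proof -
      have "r (\<lambda>x. F x + F' x) \<le> h (\<lambda>x. F x + F' x) (s + t)"
        using that F E' by (intro up) auto
      also have "\<dots> \<le> h F s + h F' t"
        using q'(1)[of "\<lambda>x. F x + s * G x" "\<lambda>x. F' x + t * G x"] F G E'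
        by (simp add: h_def algebra_simps)
      finally show ?thesis .
    qed
    have "r (\<lambda>x. F x + F' x) - h F s \<le> r F'" if "0 \<le> s" for s
      using *[OF that] by (intro great F) (simp add: algebra_simps)
    then have "r (\<lambda>x. F x + F' x) - r F' \<le> r F"
      by (intro great F) (simp add: algebra_simps)
    then show "r (\<lambda>x. F x + F' x) \<le> r F + r F'" by simp
  next
    fix c :: real and F assume c: "0 < c" and F: "F \<in> E"
    have "inverse c * r (\<lambda>x. c * F x) \<le> r F"
    proof (intro great F)
      fix t :: real assume t: "0 \<le> t"
      have "r (\<lambda>x. c * F x) \<le> h (\<lambda>x. c * F x) (c * t)"
        using t c F E' by (intro up) auto
      also have "\<dots> = c * h F t"
        using q'(2)[of "\<lambda>x. F x + t * G x" c] F G E' c by (simp add: h_def algebra_simps)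
      finally show "inverse c * r (\<lambda>x. c * F x) \<le> h F t"
        using c by (simp add: field_simps)
    qed
    then show "r (\<lambda>x. c * F x) \<le> c * r F"
      using c by (simp add: field_simps)
  qed
qed

text \<open>
  Zorn's lemma downwards: the pointwise infimum of a chain of sublinear functionals below \<open>p\<close> is
  again sublinear, and it is finite because each of them is at least \<open>- p (- F)\<close> at \<open>F\<close>.
\<close>

lemma exists_minimal_sublinear_on:
  assumes E: "function_subspace E" and p: "sublinear_on E p"
  obtains L where "sublinear_on E L" "\<And>F. F \<in> E \<Longrightarrow> L F \<le> p F"
    "\<And>q. sublinear_on E q \<Longrightarrow> \<forall>F. F \<notin> E \<longrightarrow> q F = 0 \<Longrightarrow> \<forall>F\<in>E. q F \<le> L F \<Longrightarrow> q = L"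
proof -
  note E' = function_subspaceD[OF E]
  define A where "A = {q. sublinear_on E q \<and> (\<forall>F\<in>E. q F \<le> p F) \<and> (\<forall>F. F \<notin> E \<longrightarrow> q F = 0)}"
  have "\<exists>m\<in>A. \<forall>a\<in>A. (\<forall>F. a F \<le> m F) \<longrightarrow> a = m"
  proof (rule predicate_Zorn)
    show "partial_order_on A (relation_of (\<lambda>m a. \<forall>F. a F \<le> m F) A)"
      by (rule partial_order_on_relation_ofI) (auto intro: order_trans intro!: ext antisym)
    fix C assume "C \<in> Chains (relation_of (\<lambda>m a. \<forall>F. a F \<le> m F) A)"
    then have CA: "C \<subseteq> A" and C: "\<And>q r. q \<in> C \<Longrightarrow> r \<in> C \<Longrightarrow> (\<forall>F. r F \<le> q F) \<or> (\<forall>F. q F \<le> r F)"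
      by (auto simp: Chains_def relation_of_def)
    show "\<exists>u\<in>A. \<forall>a\<in>C. \<forall>F. u F \<le> a F"
    proof (cases "C = {}")
      case True
      have "(\<lambda>F. if F \<in> E then p F else 0) \<in> A"
        using p E' by (auto simp: A_def sublinear_on_def)
      then show ?thesis using True by auto
    next
      case False
      define u where "u F = (INF q\<in>C. q F)" for F
      have low: "(if F \<in> E then - p (\<lambda>x. - F x) else 0) \<le> q F" if "q \<in> C" for q F
      proof (cases "F \<in> E")
        case True
        then have "- p (\<lambda>x. - F x) \<le> - q (\<lambda>x. - F x)"
          using that CA E'(4) by (force simp: A_def)
        also have "\<dots> \<le> q F"
          using sublinear_onD(3)[OF _ E True] that CA by (auto simp: A_def)
        finally show ?thesis using True by simp
      qed (use that CA in \<open>auto simp: A_def\<close>)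
      have bdd: "bdd_below ((\<lambda>q. q F) ` C)" for F
        using low by (intro bdd_belowI2) auto
      have up: "u F \<le> q F" if "q \<in> C" for q F
        unfolding u_def by (rule cINF_lower[OF bdd that])
      have great: "m \<le> u F" if "\<And>q. q \<in> C \<Longrightarrow> m \<le> q F" for m F
        unfolding u_def using False that by (intro cINF_greatest) auto
      obtain q0 where q0: "q0 \<in> C" using False by auto
      have "u \<in> A"
        unfolding A_def sublinear_on_def mem_Collect_eq
      proof (intro conjI ballI allI impI)
        fix F G assume F: "F \<in> E" "G \<in> E"
        have *: "u (\<lambda>x. F x + G x) \<le> q F + r G" if qr: "q \<in> C" "r \<in> C" for q r
        proof -
          \<comment> \<open>In a chain one of the two functionals lies below the other.\<close>
      obtain s where s: "s \<in> C" "s F \<le> q F" "s G \<le> r G"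
            using C[OF qr] qr by auto
          have "u (\<lambda>x. F x + G x) \<le> s (\<lambda>x. F x + G x)" by (rule up[OF s(1)])
          also have "\<dots> \<le> s F + s G"
            using s CA F by (auto simp: A_def sublinear_on_def)
          finally show ?thesis using s by simp
        qed
        have "u (\<lambda>x. F x + G x) - q F \<le> u G" if "q \<in> C" for q
          using *[OF that] by (intro great) (simp add: algebra_simps)
        then have "u (\<lambda>x. F x + G x) - u G \<le> u F"
          by (intro great) (simp add: algebra_simps)
        then show "u (\<lambda>x. F x + G x) \<le> u F + u G" by simp
      next
        fix c :: real and F assume c: "0 < c" and F: "F \<in> E"
        have "inverse c * u (\<lambda>x. c * F x) \<le> u F"
        proof (rule great)
          fix q assume q: "q \<in> C"
          have "u (\<lambda>x. c * F x) \<le> q (\<lambda>x. c * F x)" by (rule up[OF q])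
          also have "\<dots> \<le> c * q F"
            using q CA F c by (auto simp: A_def sublinear_on_def)
          finally show "inverse c * u (\<lambda>x. c * F x) \<le> q F"
            using c by (simp add: field_simps)
        qed
        then show "u (\<lambda>x. c * F x) \<le> c * u F"
          using c by (simp add: field_simps)
      next
        fix F assume "F \<in> E"
        then show "u F \<le> p F"
          using up[OF q0, of F] q0 CA by (force simp: A_def)
      next
        fix F assume F: "F \<notin> E"
        have "(\<lambda>q. q F) ` C = {0}"
          using CA F False by (force simp: A_def)
        then show "u F = 0"
          unfolding u_def by simp
      qed
      then show ?thesis using up by blast
    qed
  qed
  then obtain L where L: "L \<in> A" and min: "\<And>a. a \<in> A \<Longrightarrow> (\<forall>F. a F \<le> L F) \<Longrightarrow> a = L"
    by blast
  show ?thesis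
  proof
    show "sublinear_on E L" "\<And>F. F \<in> E \<Longrightarrow> L F \<le> p F"
      using L by (auto simp: A_def)
    fix q assume q: "sublinear_on E q" "\<forall>F. F \<notin> E \<longrightarrow> q F = 0" "\<forall>F\<in>E. q F \<le> L F"
    have "q F \<le> p F" if "F \<in> E" for F
      using q(3) L that by (force simp: A_def)
    then have "q \<in> A" using q by (auto simp: A_def)
    moreover have "q F \<le> L F" for F
      using q L by (cases "F \<in> E") (auto simp: A_def)
    ultimately show "q = L" using min by blast
  qed
qed

text \<open>
  A minimal sublinear functional coincides with each of its own linearizations, hence is linear.
  Starting the descent from the linearization of \<open>p\<close> at \<open>G\<close>, whose value at \<open>- G\<close> is at most
  \<open>- p G\<close>, leaves no room at \<open>G\<close> but \<open>L G = p G\<close>.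
\<close>

theorem hahn_banach_dominated:
  assumes E: "function_subspace E" and p: "sublinear_on E p" and G: "G \<in> E"
  obtains L where "linear_functional_on E L" "\<And>F. F \<in> E \<Longrightarrow> L F \<le> p F" "L G = p G"
proof -
  note E' = function_subspaceD[OF E]
  obtain r where r: "sublinear_on E r" "\<And>F. F \<in> E \<Longrightarrow> r F \<le> p F"
    "\<And>F. F \<in> E \<Longrightarrow> r F \<le> p (\<lambda>x. F x + G x) - p G" "\<And>F. F \<notin> E \<Longrightarrow> r F = 0"
    by (rule sublinear_on_linearize_direction[OF E p G]) (rule that)
  obtain L where L: "sublinear_on E L" "\<And>F. F \<in> E \<Longrightarrow> L F \<le> r F"
    and min: "\<And>q. sublinear_on E q \<Longrightarrow> \<forall>F. F \<notin> E \<longrightarrow> q F = 0 \<Longrightarrow> \<forall>F\<in>E. q F \<le> L F \<Longrightarrow> q = L"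
    by (rule exists_minimal_sublinear_on[OF E r(1)]) (rule that)
  note L' = sublinear_onD[OF L(1) E]
  have add: "L (\<lambda>x. F x + K x) = L F + L K" if F: "F \<in> E" and K: "K \<in> E" for F K
  proof -
    obtain q where q: "sublinear_on E q" "\<And>F. F \<in> E \<Longrightarrow> q F \<le> L F"
      "\<And>F. F \<in> E \<Longrightarrow> q F \<le> L (\<lambda>x. F x + K x) - L K" "\<And>F. F \<notin> E \<Longrightarrow> q F = 0"
      by (rule sublinear_on_linearize_direction[OF E L(1) K]) (rule that)
    then have "q = L" by (intro min) auto
    then have "L F \<le> L (\<lambda>x. F x + K x) - L K" using q(3)[OF F] by simp
    then show ?thesis using L'(1)[OF F K] by simp
  qed
  have neg: "L (\<lambda>x. - F x) = - L F" if "F \<in> E" for F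
    using add[OF that E'(4)[OF that]] L'(4) by simp
  have "L (\<lambda>x. c * F x) = c * L F" if F: "F \<in> E" for F c
  proof (cases "c \<ge> 0")
    case True
    then show ?thesis using L'(2) F by simp
  next
    case False
    then show ?thesis
      using L'(2)[OF F, of "- c"] neg[OF E'(3)[OF F, of c]] by simp
  qed
  then have lin: "linear_functional_on E L"
    using add by (auto simp: linear_functional_on_def)
  have le: "L F \<le> p F" if "F \<in> E" for F
    using L(2)[OF that] r(2)[OF that] by simp
  have "L (\<lambda>x. - G x) \<le> p (\<lambda>x. 0) - p G"
    using L(2)[OF E'(4)[OF G]] r(3)[OF E'(4)[OF G]] by simp
  then have "p G \<le> L G"
    using neg[OF G] sublinear_onD(4)[OF p E] by simp
  then show ?thesis using that lin le G by (metis antisym)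
qed


section \<open>Continuous functions vanishing at infinity\<close>

lemma C0I:
  assumes f: "continuous_on \<Omega> f"
    and K: "\<And>\<epsilon>. \<epsilon> > 0 \<Longrightarrow> \<exists>K. compact K \<and> K \<subseteq> \<Omega> \<and> (\<forall>x\<in>\<Omega> - K. \<bar>f x\<bar> < \<epsilon>)"
  shows "f \<in> C0 \<Omega>"
  unfolding C0_def mem_Collect_eq
proof (intro conjI allI impI f)
  fix \<epsilon> :: real assume "\<epsilon> > 0"
  then obtain K where K': "compact K" "K \<subseteq> \<Omega>" "\<forall>x\<in>\<Omega> - K. \<bar>f x\<bar> < \<epsilon>"
    using K by blast
  have "closedin (top_of_set K) (K \<inter> (\<lambda>x. \<bar>f x\<bar>) -` {\<epsilon>..})"
    using f K'(2) by (intro continuous_closedin_preimage continuous_intros)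
      (auto intro: continuous_on_subset)
  then have "compact (K \<inter> (\<lambda>x. \<bar>f x\<bar>) -` {\<epsilon>..})"
    using K'(1) closedin_compact by blast
  also have "K \<inter> (\<lambda>x. \<bar>f x\<bar>) -` {\<epsilon>..} = {x \<in> \<Omega>. \<bar>f x\<bar> \<ge> \<epsilon>}"
    using K'(2,3) by (auto simp: not_less[symmetric])
  finally show "compact {x \<in> \<Omega>. \<bar>f x\<bar> \<ge> \<epsilon>}" .
qed

lemma C0_continuous_on: "f \<in> C0 \<Omega> \<Longrightarrow> continuous_on \<Omega> f"
  by (simp add: C0_def)

lemma C0_compact: "f \<in> C0 \<Omega> \<Longrightarrow> \<epsilon> > 0 \<Longrightarrow> compact {x \<in> \<Omega>. \<bar>f x\<bar> \<ge> \<epsilon>}"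
  by (simp add: C0_def)

text \<open>
  Superlevel sets of \<open>g\<close> are relatively closed in superlevel sets of \<open>f\<close>. Truncations, scalings
  and products with bounded continuous functions are all handled by this lemma.
\<close>

lemma C0_dominated:
  assumes f: "f \<in> C0 \<Omega>" and g: "continuous_on \<Omega> g"
    and le: "\<And>x. x \<in> \<Omega> \<Longrightarrow> \<bar>g x\<bar> \<le> B * \<bar>f x\<bar>"
  shows "g \<in> C0 \<Omega>"
proof (rule C0I[OF g])
  fix \<epsilon> :: real assume "\<epsilon> > 0"
  \<comment> \<open>The constant \<open>B\<close> may be \<open>0\<close> or negative, so it is enlarged before dividing by it.\<close>
  define B' where "B' = max B 1"
  have B': "B' > 0" "B \<le> B'" by (auto simp: B'_def)
  define K where "K = {x \<in> \<Omega>. \<bar>f x\<bar> \<ge> \<epsilon> / B'}"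
  have "compact K"
    unfolding K_def using B' \<open>\<epsilon> > 0\<close> by (intro C0_compact[OF f]) auto
  moreover have "\<bar>g x\<bar> < \<epsilon>" if "x \<in> \<Omega> - K" for x
  proof -
    have "\<bar>g x\<bar> \<le> B' * \<bar>f x\<bar>"
      using le[of x] that B' mult_right_mono[of B B' "\<bar>f x\<bar>"] by auto
    also have "\<dots> < \<epsilon>" using that B' by (auto simp: K_def field_simps)
    finally show ?thesis .
  qed
  moreover have "K \<subseteq> \<Omega>" by (auto simp: K_def)
  ultimately show "\<exists>K. compact K \<and> K \<subseteq> \<Omega> \<and> (\<forall>x\<in>\<Omega> - K. \<bar>g x\<bar> < \<epsilon>)" by blast
qed

lemma C0_cong: "f \<in> C0 \<Omega> \<Longrightarrow> (\<And>x. x \<in> \<Omega> \<Longrightarrow> g x = f x) \<Longrightarrow> g \<in> C0 \<Omega>"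
  by (rule C0_dominated[where B = 1]) (auto simp: C0_def cong: continuous_on_cong)

lemma function_subspace_C0: "function_subspace (C0 \<Omega>)"
  unfolding function_subspace_def
proof (intro conjI ballI allI)
  show "(\<lambda>x. 0) \<in> C0 \<Omega>" by (rule C0I) (auto intro: exI[of _ "{}"])
  fix F assume F: "F \<in> C0 \<Omega>"
  show "(\<lambda>x. c * F x) \<in> C0 \<Omega>" for c
    using C0_continuous_on[OF F]
    by (intro C0_dominated[OF F, where B = "\<bar>c\<bar>"] continuous_intros) (auto simp: abs_mult)
  fix G assume G: "G \<in> C0 \<Omega>"
  show "(\<lambda>x. F x + G x) \<in> C0 \<Omega>"
  proof (rule C0I)
    show "continuous_on \<Omega> (\<lambda>x. F x + G x)"
      using F G by (intro continuous_intros C0_continuous_on)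
    fix \<epsilon> :: real assume e: "\<epsilon> > 0"
    let ?K = "{x \<in> \<Omega>. \<bar>F x\<bar> \<ge> \<epsilon> / 2} \<union> {x \<in> \<Omega>. \<bar>G x\<bar> \<ge> \<epsilon> / 2}"
    have "compact ?K" using F G e by (intro compact_Un C0_compact) auto
    moreover have "\<forall>x\<in>\<Omega> - ?K. \<bar>F x + G x\<bar> < \<epsilon>" by (auto simp: not_le) 
    moreover have "?K \<subseteq> \<Omega>" by auto
    ultimately show "\<exists>K. compact K \<and> K \<subseteq> \<Omega> \<and> (\<forall>x\<in>\<Omega> - K. \<bar>F x + G x\<bar> < \<epsilon>)" by blast
  qed
qed

lemmas C0_zero = function_subspaceD(1)[OF function_subspace_C0]
lemmas C0_add = function_subspaceD(2)[OF function_subspace_C0]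
lemmas C0_scale = function_subspaceD(3)[OF function_subspace_C0]
lemmas C0_minus = function_subspaceD(4)[OF function_subspace_C0]
lemmas C0_diff = function_subspaceD(5)[OF function_subspace_C0]

lemma C0_sum:
  assumes "finite I" "\<And>i. i \<in> I \<Longrightarrow> f i \<in> C0 \<Omega>"
  shows "(\<lambda>x. \<Sum>i\<in>I. f i x) \<in> C0 \<Omega>"
  using assms by (induction I rule: finite_induct) (auto intro: C0_zero C0_add)

lemma C0_bounded:
  assumes f: "f \<in> C0 \<Omega>"
  obtains B where "B > 0" "\<And>x. x \<in> \<Omega> \<Longrightarrow> \<bar>f x\<bar> \<le> B"
proof -
  let ?K = "{x \<in> \<Omega>. \<bar>f x\<bar> \<ge> 1}"
  have "compact (f ` ?K)"
    using C0_compact[OF f] C0_continuous_on[OF f]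
    by (intro compact_continuous_image) (auto intro: continuous_on_subset)
  then obtain B where B: "\<And>y. y \<in> f ` ?K \<Longrightarrow> \<bar>y\<bar> \<le> B"
    using compact_imp_bounded bounded_real by metis
  show ?thesis
  proof (rule that[of "max B 1"])
    fix x assume "x \<in> \<Omega>"
    then show "\<bar>f x\<bar> \<le> max B 1"
      using B[of "f x"] by (cases "\<bar>f x\<bar> \<ge> 1") auto
  qed auto
qed


section \<open>The Riesz representation theorem for positive functionals\<close>

text \<open>
  The distance to the complement, with the whole space treated separately because the distance to
  the empty set is \<open>0\<close> by convention.
\<close>

lemma open_bump_function:
  fixes T :: "'a::metric_space set"
  assumes "open T"
  obtains d :: "'a \<Rightarrow> real" where "continuous_on UNIV d" "\<And>x. 0 \<le> d x" "\<And>x. 0 < d x \<longleftrightarrow> x \<in> T"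
proof (cases "T = UNIV")
  case True
  then show ?thesis by (intro that[of "\<lambda>x. 1"]) auto
next
  case False
  have "0 < infdist x (- T) \<longleftrightarrow> x \<in> T" for x
    using False assms in_closed_iff_infdist_zero[of "- T" x] infdist_nonneg[of x "- T"]
    by (auto simp: less_le)
  then show ?thesis
    by (intro that[of "\<lambda>x. infdist x (- T)"]) (auto intro!: continuous_intros infdist_nonneg)
qed

locale positive_C0_functional =
  fixes \<Omega> :: "'a::euclidean_space set" and L :: "('a \<Rightarrow> real) \<Rightarrow> real"
  assumes linear: "linear_functional_on (C0 \<Omega>) L"
    and nonneg: "f \<in> C0 \<Omega> \<Longrightarrow> (\<And>x. x \<in> \<Omega> \<Longrightarrow> 0 \<le> f x) \<Longrightarrow> 0 \<le> L f"
    and contractive: "f \<in> C0 \<Omega> \<Longrightarrow> (\<And>x. x \<in> \<Omega> \<Longrightarrow> f x \<le> 1) \<Longrightarrow> L f \<le> 1"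
begin

lemma L_add: "f \<in> C0 \<Omega> \<Longrightarrow> g \<in> C0 \<Omega> \<Longrightarrow> L (\<lambda>x. f x + g x) = L f + L g"
  and L_scale: "f \<in> C0 \<Omega> \<Longrightarrow> L (\<lambda>x. c * f x) = c * L f"
  using linear by (auto simp: linear_functional_on_def)

lemma L_diff: "f \<in> C0 \<Omega> \<Longrightarrow> g \<in> C0 \<Omega> \<Longrightarrow> L (\<lambda>x. f x - g x) = L f - L g"
  using L_add[of f "\<lambda>x. - 1 * g x"] L_scale[of g "- 1"] C0_minus[of g] by simp

lemma L_zero: "L (\<lambda>x. 0) = 0"
  using L_scale[OF C0_zero, of 0] by simp

lemma L_sum:
  assumes "finite I" "\<And>i. i \<in> I \<Longrightarrow> f i \<in> C0 \<Omega>"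
  shows "L (\<lambda>x. \<Sum>i\<in>I. f i x) = (\<Sum>i\<in>I. L (f i))"
  using assms by (induction I rule: finite_induct) (auto simp: L_zero L_add C0_sum)

lemma L_mono:
  assumes "f \<in> C0 \<Omega>" "g \<in> C0 \<Omega>" "\<And>x. x \<in> \<Omega> \<Longrightarrow> f x \<le> g x"
  shows "L f \<le> L g"
  using nonneg[of "\<lambda>x. g x - f x"] L_diff[of g f] C0_diff[of g \<Omega> f] assms by auto

lemma L_cong:
  assumes "f \<in> C0 \<Omega>" "\<And>x. x \<in> \<Omega> \<Longrightarrow> g x = f x"
  shows "L g = L f"
  using C0_cong[OF assms] assms by (intro antisym L_mono) auto

lemma L_le:
  assumes f: "f \<in> C0 \<Omega>" and le: "\<And>x. x \<in> \<Omega> \<Longrightarrow> f x \<le> c" and c: "0 < c"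
  shows "L f \<le> c"
proof -
  have "L (\<lambda>x. inverse c * f x) \<le> 1"
    using le c by (intro contractive C0_scale f) (auto simp: field_simps)
  then have "inverse c * L f \<le> 1" by (simp only: L_scale[OF f])
  then show ?thesis using c by (simp add: field_simps)
qed

text \<open>
  The measure is built by Caratheodory's method from the content of open sets, the supremum of \<open>L\<close>
  over functions between \<open>0\<close> and the indicator of the set. Open sets are those of the ambient space,
  and only their traces on \<open>\<Omega>\<close> matter.
\<close>

definition test_functions :: "'a set \<Rightarrow> ('a \<Rightarrow> real) set" where
  "test_functions T = {f \<in> C0 \<Omega>. \<forall>x\<in>\<Omega>. 0 \<le> f x \<and> f x \<le> 1 \<and> (x \<notin> T \<longrightarrow> f x = 0)}"

definition open_content :: "'a set \<Rightarrow> ennreal" where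
  "open_content T = (SUP f\<in>test_functions T. ennreal (L f))"

definition outer :: "'a set \<Rightarrow> ennreal" where
  "outer A = (INF T\<in>{T. open T \<and> A \<subseteq> T}. open_content T)"

lemma zero_test_function: "(\<lambda>x. 0) \<in> test_functions T"
  by (simp add: test_functions_def C0_zero)

lemma test_functions_C0: "f \<in> test_functions T \<Longrightarrow> f \<in> C0 \<Omega>"
  by (simp add: test_functions_def)

lemma test_functions_mono: "T \<inter> \<Omega> \<subseteq> T' \<Longrightarrow> test_functions T \<subseteq> test_functions T'"
  by (auto simp: test_functions_def)

lemma L_le_open_content: "f \<in> test_functions T \<Longrightarrow> ennreal (L f) \<le> open_content T"
  unfolding open_content_def by (rule SUP_upper)

lemma open_content_mono: "T \<inter> \<Omega> \<subseteq> T' \<Longrightarrow> open_content T \<le> open_content T'"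
  unfolding open_content_def by (intro SUP_subset_mono test_functions_mono) auto

lemma open_content_le_1: "open_content T \<le> 1"
  unfolding open_content_def
  by (intro SUP_least) (auto simp: test_functions_def intro!: contractive)

lemma open_content_empty: "open_content {} = 0"
proof -
  have "L f \<le> 0" if "f \<in> test_functions {}" for f
    using that L_cong[OF C0_zero, of f] by (auto simp: test_functions_def L_zero)
  then show ?thesis
    unfolding open_content_def using zero_test_function
    by (auto simp: bot_ennreal[symmetric] ennreal_neg L_zero intro!: antisym SUP_least)
qed

lemma outer_le: "open T \<Longrightarrow> A \<subseteq> T \<Longrightarrow> outer A \<le> open_content T"
  unfolding outer_def by (rule INF_lower) auto

lemma outer_open:
  assumes "open T" shows "outer (\<Omega> \<inter> T) = open_content T"
  unfolding outer_def
proof (intro antisym INF_greatest INF_lower)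
  fix T' assume "T' \<in> {T'. open T' \<and> \<Omega> \<inter> T \<subseteq> T'}"
  then show "open_content T \<le> open_content T'" by (intro open_content_mono) auto
qed (use assms in auto)

lemma outer_le_1: "outer A \<le> 1"
  using outer_le[of UNIV A] open_content_le_1[of UNIV] by simp

text \<open>
  A test function \<open>f\<close> for the union is split into test functions for the pieces with a partition of
  unity made of bump functions \<open>d n\<close>. The denominator \<open>D N\<close> is the partial sum \<open>S N\<close> cut off below
  by \<open>1 / (N + 1)\<close>, so that quotients stay continuous where \<open>S N\<close> vanishes. By compactness of the
  superlevel set of \<open>f\<close> the cutoff is inactive there for large \<open>N\<close>, and elsewhere \<open>f\<close> is small.
\<close>

lemma open_content_countably_subadditive:
  assumes T: "\<And>n. open (T n)"
  shows "open_content (\<Union>n. T n) \<le> (\<Sum>n. open_content (T n))"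
proof -
  have "\<forall>n. \<exists>d :: 'a \<Rightarrow> real. continuous_on UNIV d \<and> (\<forall>x. 0 \<le> d x) \<and> (\<forall>x. 0 < d x \<longleftrightarrow> x \<in> T n)"
    using open_bump_function[OF T] by metis
  then obtain d :: "nat \<Rightarrow> 'a \<Rightarrow> real" where d_cont: "\<And>n. continuous_on UNIV (d n)"
    and d_nonneg: "\<And>n x. 0 \<le> d n x" and d_pos: "\<And>n x. 0 < d n x \<longleftrightarrow> x \<in> T n"
    by metis
  define S where "S N x = (\<Sum>n<N. d n x)" for N x
  define D where "D N x = max (S N x) (1 / (real N + 1))" for N x
  have S_cont: "continuous_on UNIV (S N)" for N
    unfolding S_def using d_cont by (intro continuous_intros)
  have S_nonneg: "0 \<le> S N x" for N x
    unfolding S_def by (intro sum_nonneg d_nonneg)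
  have S_mono: "S M x \<le> S N x" if "M \<le> N" for M N x
    unfolding S_def using that d_nonneg by (intro sum_mono2) auto
  have D_pos: "0 < D N x" for N x
    by (simp add: D_def less_max_iff_disj)
  have D_cont: "continuous_on UNIV (D N)" for N
    unfolding D_def by (intro continuous_intros S_cont)
  have S_le_D: "S N x \<le> D N x" for N x by (simp add: D_def)
  show ?thesis
    unfolding open_content_def[of "\<Union>n. T n"]
  proof (rule SUP_least)
    fix f assume f: "f \<in> test_functions (\<Union>n. T n)"
    then have fC0: "f \<in> C0 \<Omega>" and f0: "\<And>x. x \<in> \<Omega> \<Longrightarrow> 0 \<le> f x" and f1: "\<And>x. x \<in> \<Omega> \<Longrightarrow> f x \<le> 1"
      and fT: "\<And>x. x \<in> \<Omega> \<Longrightarrow> f x \<noteq> 0 \<Longrightarrow> \<exists>n. x \<in> T n"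
      by (auto simp: test_functions_def)
    show "ennreal (L f) \<le> (\<Sum>n. open_content (T n))"
    proof (rule ennreal_le_epsilon)
      fix e :: real assume e: "0 < e"
      let ?K = "{x \<in> \<Omega>. \<bar>f x\<bar> \<ge> e}"
      have "?K \<subseteq> (\<Union>N. {x. 1 / (real N + 1) < S N x})"
      proof
        fix x assume "x \<in> ?K"
        then have "x \<in> \<Omega>" "f x \<noteq> 0" using e by auto
        then obtain n where "x \<in> T n" using fT by blast
        then have pos: "0 < S (Suc n) x"
          using d_pos[of n x] S_nonneg[of n x] by (simp add: S_def)
        obtain M where M: "inverse (real (Suc M)) < S (Suc n) x"
          using reals_Archimedean[OF pos] by blast
        let ?N = "max M (Suc n)"
        have "1 / (real ?N + 1) \<le> inverse (real (Suc M))"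
          by (auto simp: field_simps)
        also note M
        also have "S (Suc n) x \<le> S ?N x" by (rule S_mono) simp
        finally show "x \<in> (\<Union>N. {x. 1 / (real N + 1) < S N x})" by blast
      qed
      moreover have "open {x. 1 / (real N + 1) < S N x}" for N
        using S_cont by (intro open_Collect_less continuous_intros) auto
      ultimately obtain I where I: "finite I" "?K \<subseteq> (\<Union>N\<in>I. {x. 1 / (real N + 1) < S N x})"
        using compactE_image[OF C0_compact[OF fC0 e], of UNIV "\<lambda>N. {x. 1 / (real N + 1) < S N x}"]
        by auto
      define N where "N = Max (insert 0 I)"
      have N: "1 / (real N + 1) < S N x" if "x \<in> ?K" for x
      proof -
        obtain M where M: "M \<in> I" "1 / (real M + 1) < S M x" using I(2) \<open>x \<in> ?K\<close> by auto
        have "M \<le> N" unfolding N_def using I(1) M(1) by (intro Max_ge) auto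
        then have "1 / (real N + 1) \<le> 1 / (real M + 1)" by (auto simp: field_simps)
        with M(2) S_mono[OF \<open>M \<le> N\<close>, of x] show ?thesis by linarith
      qed
      define g where "g n x = f x * (d n x / D N x)" for n x
      have quot: "0 \<le> d n x / D N x" "d n x / D N x \<le> 1" if "n < N" for n x
      proof -
        have "d n x \<le> S N x"
          unfolding S_def using that by (intro member_le_sum d_nonneg) auto
        then show "d n x / D N x \<le> 1" using S_le_D[of N x] D_pos[of N x] by simp
        show "0 \<le> d n x / D N x" using d_nonneg[of n x] D_pos[of N x] by simp
      qed
      have g_test: "g n \<in> test_functions (T n)" if "n < N" for n
      proof -
        have "continuous_on \<Omega> (g n)"
          unfolding g_def using D_pos[of N] C0_continuous_on[OF fC0]
          by (intro continuous_intros continuous_on_subset[OF d_cont] continuous_on_subset[OF D_cont])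
            (auto simp: less_le)
        moreover have "\<bar>g n x\<bar> \<le> 1 * \<bar>f x\<bar>" if "x \<in> \<Omega>" for x
        proof -
          have "\<bar>g n x\<bar> = \<bar>f x\<bar> * (d n x / D N x)"
            using quot(1)[OF \<open>n < N\<close>, of x] by (simp only: g_def abs_mult abs_of_nonneg)
          then show ?thesis
            using mult_left_le[OF quot(2)[OF \<open>n < N\<close>, of x], of "\<bar>f x\<bar>"] by simp
        qed
        ultimately have "g n \<in> C0 \<Omega>" by (intro C0_dominated[OF fC0, where B = 1])
        moreover have "0 \<le> g n x \<and> g n x \<le> 1" if "x \<in> \<Omega>" for x
          using quot[OF \<open>n < N\<close>, of x] f0[OF that] f1[OF that]
          unfolding g_def by (intro conjI mult_nonneg_nonneg mult_le_one)
        moreover have "g n x = 0" if "x \<notin> T n" for x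
          using that d_pos[of n x] d_nonneg[of n x] by (auto simp: g_def less_le)
        ultimately show ?thesis by (auto simp: test_functions_def)
      qed
      have g_sum: "(\<Sum>n<N. g n x) = f x * (S N x / D N x)" for x
        by (simp add: g_def S_def sum_divide_distrib sum_distrib_left)
      have gC0: "g n \<in> C0 \<Omega>" if "n \<in> {..<N}" for n
        using g_test[of n] that test_functions_C0 by blast
      have sumC0: "(\<lambda>x. \<Sum>n<N. g n x) \<in> C0 \<Omega>"
        by (intro C0_sum gC0) auto
      have "L f = L (\<lambda>x. f x - (\<Sum>n<N. g n x)) + (\<Sum>n<N. L (g n))"
        using L_diff[OF fC0 sumC0] L_sum[OF finite_lessThan gC0] by simp
      also have "L (\<lambda>x. f x - (\<Sum>n<N. g n x)) \<le> e"
      proof (rule L_le)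
        show "(\<lambda>x. f x - (\<Sum>n<N. g n x)) \<in> C0 \<Omega>"
          by (intro C0_diff fC0 sumC0)
        fix x assume x: "x \<in> \<Omega>"
        show "f x - (\<Sum>n<N. g n x) \<le> e"
        proof (cases "x \<in> ?K")
          case True
          then have "D N x = S N x" "0 < S N x" using N[OF True] D_pos[of N x] by (auto simp: D_def)
          then show ?thesis using e by (simp add: g_sum)
        next
          case False
          then have "f x \<le> e" using x by auto
          moreover have "0 \<le> f x * (S N x / D N x)"
            using f0[OF x] S_nonneg[of N x] D_pos[of N x] by simp
          ultimately show ?thesis unfolding g_sum by linarith
        qed
      qed (rule e)
      finally have "ennreal (L f) \<le> ennreal (\<Sum>n<N. L (g n)) + ennreal e"
        using e g_test by (subst ennreal_plus[symmetric])
          (auto intro!: sum_nonneg nonneg ennreal_leI simp: test_functions_def)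
      also have "ennreal (\<Sum>n<N. L (g n)) = (\<Sum>n<N. ennreal (L (g n)))"
        using g_test by (subst sum_ennreal) (auto intro!: nonneg simp: test_functions_def)
      also have "\<dots> \<le> (\<Sum>n<N. open_content (T n))"
        using g_test by (intro sum_mono L_le_open_content) auto
      also have "\<dots> \<le> (\<Sum>n. open_content (T n))"
        by (intro sum_le_suminf) auto
      finally show "ennreal (L f) \<le> (\<Sum>n. open_content (T n)) + ennreal e"
        by (simp add: add_right_mono)
    qed
  qed
qed

text \<open>
  Covering each set by an open one with excess \<open>e / 2\<^bsup>n+1\<^esup>\<close> transfers countable subadditivity from
  open sets.
\<close>

lemma outer_measure_space_outer: "outer_measure_space (Pow \<Omega>) outer"
  unfolding outer_measure_space_def
proof (intro conjI)
  show "positive (Pow \<Omega>) outer"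
    using outer_open[of "{}"] by (simp add: positive_def open_content_empty)
  show "increasing (Pow \<Omega>) outer"
    unfolding increasing_def outer_def by (auto intro!: INF_superset_mono)
  show "countably_subadditive (Pow \<Omega>) outer"
    unfolding countably_subadditive_def
  proof (intro allI impI)
    fix A :: "nat \<Rightarrow> 'a set"
    show "outer (\<Union>i. A i) \<le> (\<Sum>i. outer (A i))"
    proof (rule ennreal_le_epsilon)
      fix e :: real assume e: "0 < e"
      have "\<exists>T. open T \<and> A n \<subseteq> T \<and> open_content T \<le> outer (A n) + ennreal (e * (1/2) ^ Suc n)" for n
      proof -
        have "outer (A n) \<noteq> \<infinity>" using outer_le_1[of "A n"] by (auto simp: top_unique)
        then show ?thesis
          using INF_approx_ennreal[OF _ outer_def, of "e * (1/2) ^ Suc n" "A n"] e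
          by (force intro: less_imp_le)
      qed
      then obtain T where T: "\<And>n. open (T n)" "\<And>n. A n \<subseteq> T n"
        "\<And>n. open_content (T n) \<le> outer (A n) + ennreal (e * (1/2) ^ Suc n)"
        by metis
      have "outer (\<Union>i. A i) \<le> open_content (\<Union>n. T n)"
        using T(1,2) by (intro outer_le) auto
      also have "\<dots> \<le> (\<Sum>n. open_content (T n))"
        by (rule open_content_countably_subadditive[OF T(1)])
      also have "\<dots> \<le> (\<Sum>n. outer (A n) + ennreal (e * (1/2) ^ Suc n))"
        by (intro suminf_le T) auto
      also have "\<dots> = (\<Sum>n. outer (A n)) + (\<Sum>n. ennreal (e * (1/2) ^ Suc n))"
        by (intro suminf_add[symmetric]) auto
      also have "(\<Sum>n. ennreal (e * (1/2) ^ Suc n)) = ennreal e"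
        using e sums_mult[OF power_half_series, of e] by (intro suminf_ennreal_eq) auto
      finally show "outer (\<Union>i. A i) \<le> (\<Sum>i. outer (A i)) + ennreal e" .
    qed
  qed
qed

text \<open>
  For an open \<open>T\<close> containing \<open>A\<close>, take a nearly optimal test function \<open>f\<close> for \<open>T \<inter> U\<close> and lower it
  by \<open>e\<close>. The result \<open>h\<close> lives on the compact set \<open>{f \<ge> e} \<subseteq> U\<close>, so test functions \<open>g\<close> for the open
  set \<open>T - {f \<ge> e}\<close>, which still covers \<open>A - U\<close>, vanish wherever \<open>h\<close> does not. Hence
  \<open>h + g\<close> is a test function for \<open>T\<close>.
\<close>

lemma open_in_lambda_system:
  assumes U: "open U"
  shows "\<Omega> \<inter> U \<in> lambda_system \<Omega> (Pow \<Omega>) outer"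
proof -
  interpret algebra \<Omega> "Pow \<Omega>" by (rule algebra_Pow)
  have "outer (A \<inter> (\<Omega> \<inter> U)) + outer (A - \<Omega> \<inter> U) = outer A" if A: "A \<subseteq> \<Omega>" for A
  proof (rule antisym)
    have "subadditive (Pow \<Omega>) outer"
      using outer_measure_space_outer countably_subadditive_subadditive
      by (auto simp: outer_measure_space_def)
    then have "outer (A \<inter> (\<Omega> \<inter> U) \<union> (A - \<Omega> \<inter> U)) \<le> outer (A \<inter> (\<Omega> \<inter> U)) + outer (A - \<Omega> \<inter> U)"
      using A by (intro subadditiveD[of "Pow \<Omega>"]) auto
    then show "outer A \<le> outer (A \<inter> (\<Omega> \<inter> U)) + outer (A - \<Omega> \<inter> U)"
      by (simp add: Un_Diff_Int Un_commute)
  next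
    show "outer (A \<inter> (\<Omega> \<inter> U)) + outer (A - \<Omega> \<inter> U) \<le> outer A"
      unfolding outer_def[of A]
    proof (rule INF_greatest)
      fix T assume "T \<in> {T. open T \<and> A \<subseteq> T}"
      then have T: "open T" "A \<subseteq> T" by auto
      have "outer (A \<inter> (\<Omega> \<inter> U)) \<le> open_content (T \<inter> U)"
        using T U by (intro outer_le) auto
      then have "outer (A \<inter> (\<Omega> \<inter> U)) + outer (A - \<Omega> \<inter> U) \<le> open_content (T \<inter> U) + outer (A - \<Omega> \<inter> U)"
        by (rule add_right_mono)
      also have "\<dots> = (SUP f\<in>test_functions (T \<inter> U). ennreal (L f) + outer (A - \<Omega> \<inter> U))"
        unfolding open_content_def using zero_test_function
        by (intro ennreal_SUP_add_left[symmetric]) auto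
      also have "\<dots> \<le> open_content T"
      proof (rule SUP_least)
        fix f assume f: "f \<in> test_functions (T \<inter> U)"
        then have fC0: "f \<in> C0 \<Omega>" by (rule test_functions_C0)
        show "ennreal (L f) + outer (A - \<Omega> \<inter> U) \<le> open_content T"
        proof (rule ennreal_le_epsilon)
          fix e :: real assume e: "0 < e"
          let ?K = "{x \<in> \<Omega>. \<bar>f x\<bar> \<ge> e}"
          define h where "h x = max (f x - e) 0" for x
          have hC0: "h \<in> C0 \<Omega>"
            unfolding h_def using C0_continuous_on[OF fC0] e
            by (intro C0_dominated[OF fC0, where B = 1] continuous_intros) auto
          have fh: "ennreal (L f) \<le> ennreal (L h) + ennreal e"
          proof -
            have "L f - L h \<le> e"
              unfolding L_diff[OF fC0 hC0, symmetric]
              using e by (intro L_le C0_diff fC0 hC0) (auto simp: h_def)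
            moreover have "0 \<le> L h" by (intro nonneg hC0) (auto simp: h_def)
            ultimately show ?thesis
              using e ennreal_leI[of "L f" "L h + e"] by simp
          qed
          have "closed ?K" using C0_compact[OF fC0 e] compact_imp_closed by blast
          moreover have "A - \<Omega> \<inter> U \<subseteq> T - ?K"
            using T(2) A f e by (force simp: test_functions_def)
          ultimately have "outer (A - \<Omega> \<inter> U) \<le> open_content (T - ?K)"
            using T(1) by (intro outer_le open_Diff)
          then have "ennreal (L h) + outer (A - \<Omega> \<inter> U) \<le> ennreal (L h) + open_content (T - ?K)"
            by (rule add_left_mono)
          also have "\<dots> = (SUP g\<in>test_functions (T - ?K). ennreal (L h) + ennreal (L g))"
            unfolding open_content_def using zero_test_function
            by (intro ennreal_SUP_add_right) auto
          also have "\<dots> \<le> open_content T"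
          proof (rule SUP_least)
            fix g assume g: "g \<in> test_functions (T - ?K)"
            have "0 \<le> h x + g x \<and> h x + g x \<le> 1 \<and> (x \<notin> T \<longrightarrow> h x + g x = 0)" if "x \<in> \<Omega>" for x
              using f g that e by (cases "x \<in> ?K") (auto simp: test_functions_def h_def)
            then have "(\<lambda>x. h x + g x) \<in> test_functions T"
              using hC0 g by (auto simp: test_functions_def intro: C0_add)
            then have "ennreal (L (\<lambda>x. h x + g x)) \<le> open_content T"
              by (rule L_le_open_content)
            moreover have "L (\<lambda>x. h x + g x) = L h + L g"
              using hC0 g by (intro L_add) (auto simp: test_functions_def)
            moreover have "0 \<le> L h" "0 \<le> L g"
              using hC0 g by (auto intro!: nonneg simp: test_functions_def h_def)
            ultimately show "ennreal (L h) + ennreal (L g) \<le> open_content T"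
              by simp
          qed
          finally have h: "ennreal (L h) + outer (A - \<Omega> \<inter> U) \<le> open_content T" .
          have "ennreal (L f) + outer (A - \<Omega> \<inter> U) \<le> ennreal (L h) + ennreal e + outer (A - \<Omega> \<inter> U)"
            by (rule add_right_mono[OF fh])
          also have "\<dots> = ennreal (L h) + outer (A - \<Omega> \<inter> U) + ennreal e"
            by (simp only: add.assoc add.commute add.left_commute)
          also have "\<dots> \<le> open_content T + ennreal e"
            by (rule add_right_mono[OF h])
          finally show "ennreal (L f) + outer (A - \<Omega> \<inter> U) \<le> open_content T + ennreal e" .
        qed
      qed
      finally show "outer (A \<inter> (\<Omega> \<inter> U)) + outer (A - \<Omega> \<inter> U) \<le> open_content T" .
    qed
  qed
  then show ?thesis by (auto simp: lambda_system_eq)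
qed

definition riesz_measure :: "'a measure" where
  "riesz_measure = measure_of \<Omega> (sets (restrict_space borel \<Omega>)) outer"

lemma space_riesz_measure: "space riesz_measure = \<Omega>"
  and sets_riesz_measure: "sets riesz_measure = sets (restrict_space borel \<Omega>)"
proof -
  have "sigma_algebra \<Omega> (sets (restrict_space borel \<Omega>))"
    using sets.sigma_algebra_axioms[of "restrict_space borel \<Omega>"] by (simp add: space_restrict_space)
  then show "space riesz_measure = \<Omega>" "sets riesz_measure = sets (restrict_space borel \<Omega>)"
    unfolding riesz_measure_def
    by (auto simp: sigma_algebra.sets_measure_of_eq sigma_algebra.space_measure_of_eq)
qed

lemma emeasure_riesz_measure:
  assumes "A \<in> sets (restrict_space borel \<Omega>)"
  shows "emeasure riesz_measure A = outer A"
proof -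
  let ?L = "lambda_system \<Omega> (Pow \<Omega>) outer"
  have ms: "measure_space \<Omega> ?L outer"
    by (rule sigma_algebra.caratheodory_lemma[OF sigma_algebra_Pow outer_measure_space_outer])
  then interpret L: sigma_algebra \<Omega> ?L by (simp add: measure_space_def)
  have "\<Omega> \<inter> B \<in> ?L" if "B \<in> sets borel" for B
  proof -
    from that have "B \<in> sigma_sets UNIV {S. open S}" by (simp add: borel_def)
    then show ?thesis
    proof (induction rule: sigma_sets.induct)
      case (Basic S)
      then show ?case by (intro open_in_lambda_system) simp
    next
      case Empty
      show ?case by simp
    next
      case (Compl S)
      have "\<Omega> \<inter> (UNIV - S) = \<Omega> - \<Omega> \<inter> S" by auto
      then show ?case using L.compl_sets[OF Compl.IH] by simp
    next
      case (Union S)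
      have "\<Omega> \<inter> (\<Union>i. S i) = (\<Union>i. \<Omega> \<inter> S i)" by auto
      then show ?case using L.countable_nat_UN[of "\<lambda>i. \<Omega> \<inter> S i"] Union.IH by auto
    qed
  qed
  then have "sets (restrict_space borel \<Omega>) \<subseteq> ?L"
    by (auto simp: sets_restrict_space)
  moreover have sa: "sigma_algebra \<Omega> (sets (restrict_space borel \<Omega>))"
    using sets.sigma_algebra_axioms[of "restrict_space borel \<Omega>"] by (simp add: space_restrict_space)
  ultimately have "measure_space \<Omega> (sets (restrict_space borel \<Omega>)) outer"
    using ms measure_down by blast
  then show ?thesis
    using assms sa unfolding riesz_measure_def
    by (intro emeasure_measure_of_sigma) (auto simp: measure_space_def)
qed

lemma finite_measure_riesz: "finite_measure riesz_measure"
proof (rule finite_measureI)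
  have "emeasure riesz_measure (space riesz_measure) \<le> 1"
    using emeasure_riesz_measure[of \<Omega>] outer_le_1
    by (metis sets.top sets_riesz_measure space_riesz_measure)
  then show "emeasure riesz_measure (space riesz_measure) \<noteq> \<infinity>"
    by (auto simp: top_unique)
qed

lemma C0_measurable: "f \<in> C0 \<Omega> \<Longrightarrow> f \<in> borel_measurable riesz_measure"
  using borel_measurable_continuous_on_restrict[OF C0_continuous_on]
  by (simp add: measurable_cong_sets[OF sets_riesz_measure refl])

lemma C0_integrable:
  assumes "f \<in> C0 \<Omega>" shows "integrable riesz_measure f"
proof -
  interpret finite_measure riesz_measure by (rule finite_measure_riesz)
  obtain B where "\<And>x. x \<in> \<Omega> \<Longrightarrow> \<bar>f x\<bar> \<le> B" using C0_bounded[OF assms] by metis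
  then show ?thesis
    using C0_measurable[OF assms] by (intro integrable_const_bound[where B = B]) (auto simp: space_riesz_measure)
qed

lemma sum_layers:
  fixes t :: real
  assumes "0 \<le> t"
  shows "(\<Sum>i<N. min (max (t - real i) 0) 1) = min t (real N)"
  using assms by (induction N) (auto simp: min_def max_def)

text \<open>
  Layer cake: \<open>f\<close> is \<open>1 / N\<close> times the sum of the slices \<open>g i\<close>, and each slice lies between the
  indicators of \<open>T (i + 1)\<close> and \<open>T i\<close>, where \<open>T i = {f > i / N}\<close>. Both \<open>L (g i)\<close> and the integral
  of \<open>g i\<close> therefore lie between the measures of these sets, and the differences telescope, leaving
  an error of at most \<open>1 / N\<close>.
\<close>

lemma L_eq_integral_unit:
  assumes f: "f \<in> C0 \<Omega>" and f0: "\<And>x. x \<in> \<Omega> \<Longrightarrow> 0 \<le> f x" and f1: "\<And>x. x \<in> \<Omega> \<Longrightarrow> f x \<le> 1"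
  shows "L f = (LINT x|riesz_measure. f x)"
proof -
  interpret R: finite_measure riesz_measure by (rule finite_measure_riesz)
  \<comment> \<open>The number of slices is arbitrary and tends to infinity at the end.\<close>
  have "\<bar>L f - (LINT x|riesz_measure. f x)\<bar> \<le> inverse (real (Suc n))" for n
  proof -
    define N where "N = Suc n"
    have N: "0 < real N" by (simp add: N_def)
    define g where "g i x = min (max (N * f x - real i) 0) 1" for i x
    define T where "T i = {x \<in> \<Omega>. real i < N * f x}" for i
    define m where "m i = measure riesz_measure (T i)" for i
    have T_open: "\<exists>U. open U \<and> T i = \<Omega> \<inter> U" for i
    proof -
      have "openin (top_of_set \<Omega>) (\<Omega> \<inter> (\<lambda>x. N * f x) -` {real i<..})"
        by (intro continuous_openin_preimage_gen continuous_intros C0_continuous_on f open_greaterThan)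
      moreover have "\<Omega> \<inter> (\<lambda>x. N * f x) -` {real i<..} = T i" by (auto simp: T_def)
      ultimately show ?thesis by (auto simp: openin_open)
    qed
    have T_sets: "T i \<in> sets riesz_measure" for i
    proof -
      obtain U where U: "open U" "T i = \<Omega> \<inter> U" using T_open by blast
      then show ?thesis
        unfolding U(2) sets_riesz_measure sets_restrict_space by (intro imageI) simp
    qed
    have gC0: "g i \<in> C0 \<Omega>" for i
    proof (rule C0_dominated[OF f, where B = "real N"])
      show "continuous_on \<Omega> (g i)"
        unfolding g_def by (intro continuous_intros C0_continuous_on f)
      fix x assume "x \<in> \<Omega>"
      then have "0 \<le> real N * f x" using f0 N by simp
      then have "\<bar>g i x\<bar> \<le> real N * f x" by (simp add: g_def)
      then show "\<bar>g i x\<bar> \<le> real N * \<bar>f x\<bar>" using f0[OF \<open>x \<in> \<Omega>\<close>] by simp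
    qed
    have g_bounds: "0 \<le> g i x" "g i x \<le> 1" for i x by (auto simp: g_def)
    have g_upper: "g i x \<le> indicator (T i) x" if "x \<in> \<Omega>" for i x
      using that by (auto simp: g_def T_def indicator_def)
    have g_lower: "indicator (T (Suc i)) x \<le> g i x" if "x \<in> \<Omega>" for i x
      using that by (auto simp: g_def T_def indicator_def)
    have emeasure_T: "ennreal (m i) = open_content U" if "open U" "T i = \<Omega> \<inter> U" for i U
      using that outer_open[OF that(1)] emeasure_riesz_measure[of "T i"] T_sets[of i]
      by (simp add: m_def R.emeasure_eq_measure[symmetric] sets_riesz_measure)
    have L_upper: "L (g i) \<le> m i" for i
    proof -
      obtain U where U: "open U" "T i = \<Omega> \<inter> U" using T_open by blast
      have "g i x = 0" if "x \<in> \<Omega>" "x \<notin> U" for x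
        using g_upper[OF that(1), of i] g_bounds[of i x] that U(2) by (auto simp: indicator_def)
      then have "g i \<in> test_functions U"
        using gC0 g_bounds by (auto simp: test_functions_def)
      then have "ennreal (L (g i)) \<le> ennreal (m i)"
        using L_le_open_content emeasure_T[OF U] by simp
      then show ?thesis by (subst (asm) ennreal_le_iff) (auto simp: m_def)
    qed
    have L_lower: "m (Suc i) \<le> L (g i)" for i
    proof -
      obtain U where U: "open U" "T (Suc i) = \<Omega> \<inter> U" using T_open by blast
      have "L h \<le> L (g i)" if h: "h \<in> test_functions U" for h
      proof (rule L_mono[OF test_functions_C0[OF h] gC0])
        fix x assume x: "x \<in> \<Omega>"
        have "h x \<le> indicator (T (Suc i)) x"
          using h x U(2) by (auto simp: test_functions_def indicator_def)
        then show "h x \<le> g i x" using g_lower[OF x, of i] by linarith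
      qed
      then have "open_content U \<le> ennreal (L (g i))"
        unfolding open_content_def by (intro SUP_least ennreal_leI)
      then have "ennreal (m (Suc i)) \<le> ennreal (L (g i))"
        by (simp add: emeasure_T[OF U])
      then show ?thesis
        using nonneg[OF gC0, of i] g_bounds by (subst (asm) ennreal_le_iff) auto
    qed
    have int_ind: "(LINT x|riesz_measure. indicator (T i) x) = m i" for i
      using T_sets[of i] by (simp add: m_def)
    have "(LINT x|riesz_measure. g i x) \<le> (LINT x|riesz_measure. indicator (T i) x)" for i
      using T_sets gC0 g_upper
      by (intro integral_mono C0_integrable[OF gC0]) (auto simp: space_riesz_measure R.emeasure_eq_measure)
    then have I_upper: "(LINT x|riesz_measure. g i x) \<le> m i" for i by (simp only: int_ind)
    have "(LINT x|riesz_measure. indicator (T (Suc i)) x) \<le> (LINT x|riesz_measure. g i x)" for i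
      using T_sets gC0 g_lower
      by (intro integral_mono C0_integrable[OF gC0]) (auto simp: space_riesz_measure R.emeasure_eq_measure)
    then have I_lower: "m (Suc i) \<le> (LINT x|riesz_measure. g i x)" for i by (simp only: int_ind)
    have f_eq: "f x = inverse N * (\<Sum>i<N. g i x)" if "x \<in> \<Omega>" for x
    proof -
      have "(\<Sum>i<N. g i x) = min (N * f x) N"
        unfolding g_def using f0[OF that] by (intro sum_layers) auto
      also have "\<dots> = N * f x"
        using f1[OF that] N by (simp add: mult_left_le)
      finally show ?thesis using N by simp
    qed
    have sumC0: "(\<lambda>x. \<Sum>i<N. g i x) \<in> C0 \<Omega>" by (intro C0_sum gC0) auto
    have "L f = L (\<lambda>x. inverse N * (\<Sum>i<N. g i x))"
      using f_eq sumC0 by (intro L_cong C0_scale) auto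
    also have "\<dots> = inverse N * (\<Sum>i<N. L (g i))"
      using L_sum[of "{..<N}" g] gC0 by (simp only: L_scale[OF sumC0]) auto
    finally have Lf: "L f = inverse N * (\<Sum>i<N. L (g i))" .
    have "(LINT x|riesz_measure. f x) = (LINT x|riesz_measure. inverse N * (\<Sum>i<N. g i x))"
      using f_eq by (intro Bochner_Integration.integral_cong) (auto simp: space_riesz_measure)
    also have "\<dots> = inverse N * (\<Sum>i<N. LINT x|riesz_measure. g i x)"
      using C0_integrable[OF gC0] by (simp only: integral_mult_right_zero Bochner_Integration.integral_sum)
    finally have If: "(LINT x|riesz_measure. f x) = inverse N * (\<Sum>i<N. LINT x|riesz_measure. g i x)" .
    have "\<bar>\<Sum>i<N. L (g i) - (LINT x|riesz_measure. g i x)\<bar> \<le> (\<Sum>i<N. m i - m (Suc i))"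
    proof (intro order_trans[OF sum_abs] sum_mono)
      fix i
      show "\<bar>L (g i) - (LINT x|riesz_measure. g i x)\<bar> \<le> m i - m (Suc i)"
        using L_upper[of i] L_lower[of i] I_upper[of i] I_lower[of i] by linarith
    qed
    also have "\<dots> = m 0 - m N" by (rule sum_lessThan_telescope')
    also have "\<dots> \<le> 1"
    proof -
      obtain U where U: "open U" "T 0 = \<Omega> \<inter> U" using T_open by blast
      have "ennreal (m 0) \<le> 1" using emeasure_T[OF U] open_content_le_1 by simp
      then have "m 0 \<le> 1" by (simp add: m_def)
      moreover have "0 \<le> m N" by (simp add: m_def)
      ultimately show ?thesis by linarith
    qed
    finally have "inverse N * \<bar>\<Sum>i<N. L (g i) - (LINT x|riesz_measure. g i x)\<bar> \<le> inverse N * 1"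
      by (intro mult_left_mono) auto
    then show ?thesis
      unfolding Lf If sum_subtractf N_def[symmetric] by (simp only: right_diff_distrib[symmetric] abs_mult) simp
  qed
  then have "\<bar>L f - (LINT x|riesz_measure. f x)\<bar> \<le> 0"
    by (intro LIMSEQ_le_const[OF LIMSEQ_inverse_real_of_nat]) auto
  then show ?thesis by simp
qed

theorem L_eq_integral:
  assumes f: "f \<in> C0 \<Omega>"
  shows "L f = (LINT x|riesz_measure. f x)"
proof -
  obtain B where B: "B > 0" "\<And>x. x \<in> \<Omega> \<Longrightarrow> \<bar>f x\<bar> \<le> B" using C0_bounded[OF f] by metis
  define p n where "p x = inverse B * max (f x) 0" and "n x = inverse B * max (- f x) 0" for x
  have pn: "p \<in> C0 \<Omega>" "n \<in> C0 \<Omega>"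
    unfolding p_def n_def using C0_continuous_on[OF f] B(1)
    by (auto intro!: C0_dominated[OF f, where B = "inverse B"] continuous_intros)
  have pn01: "0 \<le> p x" "p x \<le> 1" "0 \<le> n x" "n x \<le> 1" if "x \<in> \<Omega>" for x
    using B(1) B(2)[OF that] by (auto simp: p_def n_def field_simps)
  have f_eq: "f = (\<lambda>x. B * (p x - n x))"
    using B(1) by (auto simp: p_def n_def field_simps max_def)
  have "L f = B * (L p - L n)"
    by (subst f_eq) (simp only: L_scale[OF C0_diff[OF pn]] L_diff[OF pn])
  also have "L p = (LINT x|riesz_measure. p x)" using pn pn01 by (intro L_eq_integral_unit) auto
  also have "L n = (LINT x|riesz_measure. n x)" using pn pn01 by (intro L_eq_integral_unit) auto
  also have "B * ((LINT x|riesz_measure. p x) - (LINT x|riesz_measure. n x)) = (LINT x|riesz_measure. f x)"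
    by (subst f_eq) (simp add: C0_integrable pn)
  finally show ?thesis .
qed

end


section \<open>Integration against a difference of finite measures\<close>

lemma signed_measure_measure_diff:
  assumes M: "finite_measure M" "sets M = sets B" and N: "finite_measure N" "sets N = sets B"
  shows "signed_measure B (\<lambda>A. measure M A - measure N A)"
  unfolding signed_measure_def
  using finite_measure.finite_measure_UNION[OF M(1)] finite_measure.finite_measure_UNION[OF N(1)] M(2) N(2)
  by (auto intro!: sums_diff)

text \<open>
  If \<open>Y\<close> is the positive set of a Hahn decomposition, the supremum that defines the positive
  variation of \<open>A\<close> is attained at \<open>A \<inter> Y\<close>.
\<close>

lemma pos_variation_measure_diff:
  assumes M: "finite_measure M" "sets M = sets B" and N: "finite_measure N" "sets N = sets B"
    and Y: "Y \<in> sets B"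
    and pos: "\<forall>X\<in>sets B. X \<subseteq> Y \<longrightarrow> measure N X \<le> measure M X"
    and neg: "\<forall>X\<in>sets B. X \<inter> Y = {} \<longrightarrow> measure M X \<le> measure N X"
  defines "P \<equiv> pos_variation B (\<lambda>A. measure M A - measure N A)"
  shows "space P = space B" and "sets P = sets B"
    and "A \<in> sets B \<Longrightarrow> emeasure P A = ennreal (measure M (A \<inter> Y) - measure N (A \<inter> Y))"
    and "finite_measure P"
proof -
  interpret M: finite_measure M by fact
  interpret N: finite_measure N by fact
  define \<mu> where "\<mu> A = measure M A - measure N A" for A
  have split: "\<mu> C = \<mu> (C \<inter> D) + \<mu> (C - D)" if "C \<in> sets B" "D \<in> sets B" for C D
  proof -
    have CD: "C = (C \<inter> D) \<union> (C - D)" by auto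
    have "measure M C = measure M (C \<inter> D) + measure M (C - D)"
      by (subst CD, rule M.finite_measure_Union) (use that M(2) in auto)
    moreover have "measure N C = measure N (C \<inter> D) + measure N (C - D)"
      by (subst CD, rule N.finite_measure_Union) (use that N(2) in auto)
    ultimately show ?thesis by (simp add: \<mu>_def)
  qed
  have pos': "0 \<le> \<mu> (C \<inter> Y)" if "C \<in> sets B" for C
    using pos that Y by (auto simp: \<mu>_def)
  have "\<mu> C \<le> \<mu> (A \<inter> Y)" if "C \<in> sets B" "A \<in> sets B" "C \<subseteq> A" for C A
  proof -
    have "\<mu> C \<le> \<mu> (C \<inter> Y)"
      using split[OF that(1) Y] bspec[OF neg, of "C - Y"] that Y by (auto simp: \<mu>_def)
    also have "\<mu> (C \<inter> Y) \<le> \<mu> (A \<inter> Y)"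
    proof -
      have "\<mu> (A \<inter> Y) = \<mu> (A \<inter> Y \<inter> C) + \<mu> (A \<inter> Y - C)"
        using that Y by (intro split) auto
      moreover have "A \<inter> Y \<inter> C = C \<inter> Y" "A \<inter> Y - C = (A - C) \<inter> Y" using that by auto
      ultimately show ?thesis
        using pos'[of "A - C"] that Y by simp
    qed
    finally show ?thesis .
  qed
  then have SUP: "(SUP C\<in>{C \<in> sets B. C \<subseteq> A}. ennreal (\<mu> C)) = ennreal (\<mu> (A \<inter> Y))" if "A \<in> sets B" for A
    using that Y by (intro antisym SUP_least SUP_upper ennreal_leI) auto
  have P: "P = measure_of (space B) (sets B) (\<lambda>A. SUP C\<in>{C \<in> sets B. C \<subseteq> A}. ennreal (\<mu> C))"
    by (simp add: P_def pos_variation_def \<mu>_def)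
  show space: "space P = space B" and sets: "sets P = sets B"
    unfolding P by simp_all
  have em: "emeasure P A = ennreal (\<mu> (A \<inter> Y))" if A: "A \<in> sets B" for A
  proof -
    have "emeasure P A = (SUP C\<in>{C \<in> sets B. C \<subseteq> A}. ennreal (\<mu> C))"
      unfolding P
    proof (rule emeasure_measure_of_sigma[OF sets.sigma_algebra_axioms])
      show "positive (sets B) (\<lambda>A. SUP C\<in>{C \<in> sets B. C \<subseteq> A}. ennreal (\<mu> C))"
        using SUP[of "{}"] by (simp add: positive_def \<mu>_def)
      show "countably_additive (sets B) (\<lambda>A. SUP C\<in>{C \<in> sets B. C \<subseteq> A}. ennreal (\<mu> C))"
        unfolding countably_additive_def
      proof (intro allI impI)
        fix A :: "nat \<Rightarrow> _"
        assume A: "range A \<subseteq> sets B" "disjoint_family A" "(\<Union>i. A i) \<in> sets B"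
        have "(\<lambda>i. \<mu> (A i \<inter> Y)) sums \<mu> (\<Union>i. A i \<inter> Y)"
          using signed_measure_measure_diff[OF M N] A Y
          unfolding signed_measure_def \<mu>_def
          by (auto simp: disjoint_family_on_def image_subset_iff elim!: allE[where x = "\<lambda>i. A i \<inter> Y"])
        moreover have "(\<Union>i. A i \<inter> Y) = (\<Union>i. A i) \<inter> Y" by auto
        ultimately have "(\<Sum>i. ennreal (\<mu> (A i \<inter> Y))) = ennreal (\<mu> ((\<Union>i. A i) \<inter> Y))"
          using A pos' by (intro suminf_ennreal_eq) auto
        then show "(\<Sum>i. SUP C\<in>{C \<in> sets B. C \<subseteq> A i}. ennreal (\<mu> C))
            = (SUP C\<in>{C \<in> sets B. C \<subseteq> (\<Union>i. A i)}. ennreal (\<mu> C))"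
          using A SUP by (simp add: image_subset_iff)
      qed
    qed (rule A)
    then show ?thesis using SUP[OF A] by simp
  qed
  then show "A \<in> sets B \<Longrightarrow> emeasure P A = ennreal (measure M (A \<inter> Y) - measure N (A \<inter> Y))"
    by (simp add: \<mu>_def)
  show "finite_measure P"
    using em[of "space B"] space by (intro finite_measureI) auto
qed

lemma nn_integral_add_measures_cong:
  assumes sets: "sets N = sets M" "sets P = sets M" "sets Q = sets M"
    and eq: "\<And>A. A \<in> sets M \<Longrightarrow> emeasure M A + emeasure Q A = emeasure N A + emeasure P A"
    and f: "f \<in> borel_measurable M"
  shows "(\<integral>\<^sup>+x. f x \<partial>M) + (\<integral>\<^sup>+x. f x \<partial>Q) = (\<integral>\<^sup>+x. f x \<partial>N) + (\<integral>\<^sup>+x. f x \<partial>P)"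
proof -
  note space = sets_eq_imp_space_eq[OF sets(1)] sets_eq_imp_space_eq[OF sets(2)] sets_eq_imp_space_eq[OF sets(3)]
  have meas: "f \<in> borel_measurable M'" if "f \<in> borel_measurable M" "M' \<in> {M, N, P, Q}"
    for f :: "'a \<Rightarrow> ennreal" and M'
  proof -
    have "sets M' = sets M" using that(2) sets by auto
    then show ?thesis using that(1) measurable_cong_sets[OF _ refl] by blast
  qed
  show ?thesis
    using f
  proof (induction rule: borel_measurable_induct)
    case (cong f g)
    then have "(\<integral>\<^sup>+x. f x \<partial>M') = (\<integral>\<^sup>+x. g x \<partial>M')" if "M' \<in> {M, N, P, Q}" for M'
      using that space by (intro nn_integral_cong) auto
    then show ?case using cong by simp
  next
    case (set A)
    then show ?case using eq sets by simp
  next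
    case (mult u c)
    then show ?case using meas[OF mult(2)] by (simp add: nn_integral_cmult distrib_left[symmetric])
  next
    case (add u v)
    then show ?case
      using meas[OF add(1)] meas[OF add(3)] by (simp add: nn_integral_add) (metis add.assoc add.left_commute)
  next
    case (seq U)
    have SUP: "(\<integral>\<^sup>+x. (SUP i. U i) x \<partial>M') = (SUP i. \<integral>\<^sup>+x. U i x \<partial>M')" if "M' \<in> {M, N, P, Q}" for M'
      using meas[OF seq(1) that] \<open>incseq U\<close> by (simp add: nn_integral_monotone_convergence_SUP image_comp)
    have inc: "incseq (\<lambda>i. \<integral>\<^sup>+x. U i x \<partial>M')" for M'
      using \<open>incseq U\<close> by (auto simp: incseq_def le_fun_def intro!: nn_integral_mono)
    have mem: "M \<in> {M, N, P, Q}" "N \<in> {M, N, P, Q}" "P \<in> {M, N, P, Q}" "Q \<in> {M, N, P, Q}"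
      by auto
    show ?case
      unfolding SUP[OF mem(1)] SUP[OF mem(2)] SUP[OF mem(3)] SUP[OF mem(4)]
        ennreal_SUP_add[OF inc inc, symmetric]
      using seq.IH by simp
  qed
qed

text \<open>
  Adding a constant reduces bounded functions to nonnegative ones, for which the Lebesgue integral
  in \<open>[0, \<infinity>]\<close> can be compared without subtractions.
\<close>

lemma integral_add_measures_cong:
  assumes fin: "finite_measure M" "finite_measure N" "finite_measure P" "finite_measure Q"
    and sets: "sets N = sets M" "sets P = sets M" "sets Q = sets M"
    and eq: "\<And>A. A \<in> sets M \<Longrightarrow> emeasure M A + emeasure Q A = emeasure N A + emeasure P A"
    and f: "f \<in> borel_measurable M" and bound: "\<And>x. x \<in> space M \<Longrightarrow> \<bar>f x\<bar> \<le> B"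
  shows "(LINT x|M. f x) + (LINT x|Q. f x) = (LINT x|N. f x) + (LINT x|P. (f x :: real))"
proof -
  note space = sets_eq_imp_space_eq[OF sets(1)] sets_eq_imp_space_eq[OF sets(2)] sets_eq_imp_space_eq[OF sets(3)]
  have fin': "finite_measure M'" if "M' \<in> {M, N, P, Q}" for M' using fin that by auto
  have int: "integrable M' g"
    if "g \<in> borel_measurable M" "\<And>x. x \<in> space M \<Longrightarrow> \<bar>g x\<bar> \<le> C" "M' \<in> {M, N, P, Q}" for g :: "'a \<Rightarrow> real" and C M'
  proof -
    have "sets M' = sets M" "space M' = space M" using that(3) sets space by auto
    moreover from this have "g \<in> borel_measurable M'"
      using that(1) measurable_cong_sets[OF _ refl] by blast
    ultimately show ?thesis
      using that(2)
      by (intro finite_measure.integrable_const_bound[OF fin'[OF that(3)], where B = C]) auto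
  qed
  have nonneg_case: "(LINT x|M. g x) + (LINT x|Q. g x) = (LINT x|N. g x) + (LINT x|P. g x)"
    if g: "g \<in> borel_measurable M" "\<And>x. x \<in> space M \<Longrightarrow> \<bar>g x\<bar> \<le> C" "\<And>x. x \<in> space M \<Longrightarrow> 0 \<le> g x"
    for g :: "'a \<Rightarrow> real" and C
  proof -
    have *: "(\<integral>\<^sup>+x. ennreal (g x) \<partial>M') = ennreal (LINT x|M'. g x)" "0 \<le> (LINT x|M'. g x)"
      if "M' \<in> {M, N, P, Q}" for M'
      using that g(3) space int[OF g(1,2) that]
      by (auto intro!: nn_integral_eq_integral integral_nonneg_AE AE_I2)
    have "(\<integral>\<^sup>+x. ennreal (g x) \<partial>M) + (\<integral>\<^sup>+x. ennreal (g x) \<partial>Q)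
        = (\<integral>\<^sup>+x. ennreal (g x) \<partial>N) + (\<integral>\<^sup>+x. ennreal (g x) \<partial>P)"
      using g(1) by (intro nn_integral_add_measures_cong[OF sets eq]) auto
    then have "ennreal ((LINT x|M. g x) + (LINT x|Q. g x)) = ennreal ((LINT x|N. g x) + (LINT x|P. g x))"
      using * by simp
    then show ?thesis using * by (subst (asm) ennreal_inj) auto
  qed
  define c where "c = \<bar>B\<bar>"
  have c: "0 \<le> c" "\<And>x. x \<in> space M \<Longrightarrow> \<bar>f x\<bar> \<le> c" using bound by (force simp: c_def)+
  have "(LINT x|M. f x + c) + (LINT x|Q. f x + c) = (LINT x|N. f x + c) + (LINT x|P. f x + c)"
    using f c by (intro nonneg_case[where C = "2 * c"]) (force simp: abs_le_iff)+
  moreover have "(LINT x|M. c) + (LINT x|Q. c) = (LINT x|N. c) + (LINT x|P. c)"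
    using c(1) by (intro nonneg_case[where C = c]) auto
  moreover have "(LINT x|M'. f x + c) = (LINT x|M'. f x) + (LINT x|M'. c)" if "M' \<in> {M, N, P, Q}" for M'
    using int[OF f c(2) that] int[of "\<lambda>x. c" c, OF _ _ that] c(1) by (intro Bochner_Integration.integral_add) auto
  ultimately show ?thesis by simp
qed

text \<open>
  With \<open>P\<close> and \<open>Q\<close> the positive and negative variations of \<open>M - N\<close>, the equation
  \<open>P - Q = M - N\<close> is used in the subtraction-free form \<open>P + N = Q + M\<close>.
\<close>

theorem signed_integral_measure_diff:
  assumes M: "finite_measure M" "sets M = sets B" and N: "finite_measure N" "sets N = sets B"
    and f: "f \<in> borel_measurable B" and bound: "\<And>x. x \<in> space B \<Longrightarrow> \<bar>f x\<bar> \<le> C"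
  shows "signed_integral B (\<lambda>A. measure M A - measure N A) f = (LINT x|M. f x) - (LINT x|N. f x)"
proof -
  interpret M: finite_measure M by fact
  interpret N: finite_measure N by fact
  obtain Y where Y: "Y \<in> sets B" and pos: "\<forall>X\<in>sets B. X \<subseteq> Y \<longrightarrow> measure N X \<le> measure M X"
    and neg: "\<forall>X\<in>sets B. X \<inter> Y = {} \<longrightarrow> measure M X \<le> measure N X"
    using finite_unsigned_Hahn_decomposition[OF M(1) N(1)] M(2) N(2)
    by (auto simp: M.emeasure_eq_measure N.emeasure_eq_measure)
  let ?P = "pos_variation B (\<lambda>A. measure M A - measure N A)"
  let ?Q = "pos_variation B (\<lambda>A. measure N A - measure M A)"
  let ?Z = "space B - Y"
  have pos': "\<forall>X\<in>sets B. X \<subseteq> ?Z \<longrightarrow> measure M X \<le> measure N X"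
    using neg by auto
  have neg': "\<forall>X\<in>sets B. X \<inter> ?Z = {} \<longrightarrow> measure N X \<le> measure M X"
    using pos sets.sets_into_space[of _ B] by blast
  have Z: "?Z \<in> sets B" using Y by auto
  note P = pos_variation_measure_diff[OF M N Y pos neg]
  note Q = pos_variation_measure_diff[OF N M Z pos' neg']
  have "emeasure ?P A + emeasure N A = emeasure ?Q A + emeasure M A" if A: "A \<in> sets ?P" for A
  proof -
    have A': "A \<in> sets B" using A P(2) by simp
    have AZ: "A \<inter> ?Z = A - Y" using sets.sets_into_space[OF A'] by auto
    have eq: "A = (A \<inter> Y) \<union> (A - Y)" by auto
    have 1: "measure M A = measure M (A \<inter> Y) + measure M (A - Y)"
      by (subst eq, rule M.finite_measure_Union) (use A' Y M(2) in auto)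
    have 2: "measure N A = measure N (A \<inter> Y) + measure N (A - Y)"
      by (subst eq, rule N.finite_measure_Union) (use A' Y N(2) in auto)
    have 3: "measure N (A \<inter> Y) \<le> measure M (A \<inter> Y)" "measure M (A - Y) \<le> measure N (A - Y)"
      using bspec[OF pos, of "A \<inter> Y"] bspec[OF neg, of "A - Y"] A' Y by auto
    have "emeasure ?P A + emeasure N A
        = ennreal (measure M (A \<inter> Y) - measure N (A \<inter> Y) + measure N A)"
      using P(3)[OF A'] 3 by (simp add: N.emeasure_eq_measure)
    also have "\<dots> = ennreal (measure N (A - Y) - measure M (A - Y) + measure M A)"
      using 1 2 by simp
    also have "\<dots> = emeasure ?Q A + emeasure M A"
      using Q(3)[OF A'] 3 AZ by (simp add: M.emeasure_eq_measure)
    finally show ?thesis .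
  qed
  then have "(LINT x|?P. f x) + (LINT x|N. f x) = (LINT x|?Q. f x) + (LINT x|M. f x)"
    using P(1,2,4) Q(2,4) M N bound f measurable_cong_sets[OF P(2) refl, of borel]
    by (intro integral_add_measures_cong[where B = C]) auto
  then show ?thesis
    by (simp add: signed_integral_def)
qed


section \<open>Density in \<open>C\<^sub>0(\<Omega>)\<close> by duality\<close>

text \<open>
  The supremum of the positive part of \<open>f\<close> on \<open>\<Omega>\<close>; inserting \<open>0\<close> also covers empty \<open>\<Omega>\<close>. A linear
  functional below it is automatically positive and contractive.
\<close>

definition sup0 :: "'a set \<Rightarrow> ('a \<Rightarrow> real) \<Rightarrow> real" where
  "sup0 \<Omega> f = Sup (insert 0 (f ` \<Omega>))"

lemma sup0_least: "0 \<le> c \<Longrightarrow> (\<And>x. x \<in> \<Omega> \<Longrightarrow> f x \<le> c) \<Longrightarrow> sup0 \<Omega> f \<le> c"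
  unfolding sup0_def by (rule cSup_least) auto

lemma sup0_upper:
  assumes "f \<in> C0 \<Omega>"
  shows "0 \<le> sup0 \<Omega> f" and "x \<in> \<Omega> \<Longrightarrow> f x \<le> sup0 \<Omega> f"
proof -
  obtain B where "B > 0" "\<And>x. x \<in> \<Omega> \<Longrightarrow> \<bar>f x\<bar> \<le> B" using C0_bounded[OF assms] by metis
  then have "bdd_above (insert 0 (f ` \<Omega>))"
    by (intro bdd_aboveI[of _ B]) (force simp: abs_le_iff)
  then show "0 \<le> sup0 \<Omega> f" "x \<in> \<Omega> \<Longrightarrow> f x \<le> sup0 \<Omega> f"
    unfolding sup0_def by (auto intro!: cSup_upper)
qed

lemma sup0_add: "f \<in> C0 \<Omega> \<Longrightarrow> g \<in> C0 \<Omega> \<Longrightarrow> sup0 \<Omega> (\<lambda>x. f x + g x) \<le> sup0 \<Omega> f + sup0 \<Omega> g"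
  by (intro sup0_least add_nonneg_nonneg add_mono sup0_upper)

lemma sup0_scale: "f \<in> C0 \<Omega> \<Longrightarrow> 0 < c \<Longrightarrow> sup0 \<Omega> (\<lambda>x. c * f x) \<le> c * sup0 \<Omega> f"
  by (intro sup0_least mult_nonneg_nonneg mult_left_mono sup0_upper) auto

text \<open>
  A pair of functions is encoded as one real function on two copies of the space, so that the
  Hahn-Banach theorem for function spaces applies.
\<close>

definition pairing :: "('a \<Rightarrow> real) \<Rightarrow> ('a \<Rightarrow> real) \<Rightarrow> 'a \<times> bool \<Rightarrow> real" where
  "pairing f h = (\<lambda>(x, b). if b then f x else h x)"

lemma pairing_simps [simp]: "pairing f h (x, True) = f x" "pairing f h (x, False) = h x"
  by (simp_all add: pairing_def)

lemma pairing_add: "(\<lambda>z. pairing f h z + pairing f' h' z) = pairing (\<lambda>x. f x + f' x) (\<lambda>x. h x + h' x)"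
  and pairing_scale: "(\<lambda>z. c * pairing f h z) = pairing (\<lambda>x. c * f x) (\<lambda>x. c * h x)"
  by (auto simp: pairing_def)

definition pairs_C0 :: "'a::topological_space set \<Rightarrow> ('a \<times> bool \<Rightarrow> real) set" where
  "pairs_C0 \<Omega> = {F. (\<lambda>x. F (x, True)) \<in> C0 \<Omega> \<and> (\<lambda>x. F (x, False)) \<in> C0 \<Omega>}"

lemma function_subspace_pairs_C0: "function_subspace (pairs_C0 \<Omega>)"
  unfolding function_subspace_def pairs_C0_def by (auto intro: C0_zero C0_add C0_scale)

text \<open>
  The sublinear functional for the duality argument. Taking \<open>v = 0\<close> bounds it by the suprema
  of the positive parts of the two components, so a linear functional below it has positive components
  \<open>L1\<close>, \<open>L2\<close>. At \<open>(v, -v)\<close> with \<open>v \<in> V\<close> it is at most \<open>0\<close>, so \<open>L1\<close> and \<open>L2\<close> agree on \<open>V\<close>.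
  At \<open>(g, -g)\<close> it is at least the uniform distance from \<open>g\<close> to \<open>V\<close>.
\<close>

definition split_dist :: "'a::topological_space set \<Rightarrow> ('a \<Rightarrow> real) set \<Rightarrow> ('a \<times> bool \<Rightarrow> real) \<Rightarrow> real" where
  "split_dist \<Omega> V F =
     (INF v\<in>V. sup0 \<Omega> (\<lambda>x. F (x, True) + v x) + sup0 \<Omega> (\<lambda>x. F (x, False) - v x))"

lemma split_dist_le:
  assumes V: "V \<subseteq> C0 \<Omega>" and F: "F \<in> pairs_C0 \<Omega>" and v: "v \<in> V"
  shows "split_dist \<Omega> V F \<le> sup0 \<Omega> (\<lambda>x. F (x, True) + v x) + sup0 \<Omega> (\<lambda>x. F (x, False) - v x)"
  unfolding split_dist_def
proof (rule cINF_lower[OF _ v], rule bdd_belowI2[where m = 0])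
  fix v assume "v \<in> V"
  then show "0 \<le> sup0 \<Omega> (\<lambda>x. F (x, True) + v x) + sup0 \<Omega> (\<lambda>x. F (x, False) - v x)"
    using V F by (intro add_nonneg_nonneg sup0_upper C0_add C0_diff) (auto simp: pairs_C0_def)
qed

lemma sublinear_split_dist:
  assumes V: "function_subspace V" "V \<subseteq> C0 \<Omega>"
  shows "sublinear_on (pairs_C0 \<Omega>) (split_dist \<Omega> V)"
proof -
  note V' = function_subspaceD[OF V(1)] and E = function_subspaceD[OF function_subspace_pairs_C0]
  let ?s = "\<lambda>F v. sup0 \<Omega> (\<lambda>x. F (x, True) + v x) + sup0 \<Omega> (\<lambda>x. F (x, False) - v x)"
  have great: "m \<le> split_dist \<Omega> V F" if "\<And>v. v \<in> V \<Longrightarrow> m \<le> ?s F v" for m F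
    unfolding split_dist_def using V'(1) that by (intro cINF_greatest) auto
  have in_C0: "(\<lambda>x. F (x, True) + v x) \<in> C0 \<Omega>" "(\<lambda>x. F (x, False) - v x) \<in> C0 \<Omega>"
    if "F \<in> pairs_C0 \<Omega>" "v \<in> V" for F v
    using that V(2) by (auto simp: pairs_C0_def intro!: C0_add C0_diff)
  show ?thesis
    unfolding sublinear_on_def
  proof (intro conjI ballI allI impI)
    fix F G assume FG: "F \<in> pairs_C0 \<Omega>" "G \<in> pairs_C0 \<Omega>"
    have *: "split_dist \<Omega> V (\<lambda>z. F z + G z) \<le> ?s F v + ?s G w" if vw: "v \<in> V" "w \<in> V" for v w
    proof -
      have "split_dist \<Omega> V (\<lambda>z. F z + G z) \<le> ?s (\<lambda>z. F z + G z) (\<lambda>x. v x + w x)"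
        by (rule split_dist_le[OF V(2) E(2)[OF FG] V'(2)[OF vw]])
      moreover have "sup0 \<Omega> (\<lambda>x. (F (x, True) + v x) + (G (x, True) + w x))
          \<le> sup0 \<Omega> (\<lambda>x. F (x, True) + v x) + sup0 \<Omega> (\<lambda>x. G (x, True) + w x)"
        using FG vw by (intro sup0_add in_C0)
      moreover have "sup0 \<Omega> (\<lambda>x. (F (x, False) - v x) + (G (x, False) - w x))
          \<le> sup0 \<Omega> (\<lambda>x. F (x, False) - v x) + sup0 \<Omega> (\<lambda>x. G (x, False) - w x)"
        using FG vw by (intro sup0_add in_C0)
      ultimately show ?thesis by (simp add: algebra_simps)
    qed
    have "split_dist \<Omega> V (\<lambda>z. F z + G z) - ?s F v \<le> split_dist \<Omega> V G" if "v \<in> V" for v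
      using *[OF that] by (intro great) (simp add: algebra_simps)
    then have "split_dist \<Omega> V (\<lambda>z. F z + G z) - split_dist \<Omega> V G \<le> split_dist \<Omega> V F"
      by (intro great) (simp add: algebra_simps)
    then show "split_dist \<Omega> V (\<lambda>z. F z + G z) \<le> split_dist \<Omega> V F + split_dist \<Omega> V G" by simp
  next
    fix c :: real and F assume c: "0 < c" and F: "F \<in> pairs_C0 \<Omega>"
    have "inverse c * split_dist \<Omega> V (\<lambda>z. c * F z) \<le> split_dist \<Omega> V F"
    proof (rule great)
      fix v assume v: "v \<in> V"
      have "split_dist \<Omega> V (\<lambda>z. c * F z) \<le> ?s (\<lambda>z. c * F z) (\<lambda>x. c * v x)"
        by (rule split_dist_le[OF V(2) E(3)[OF F] V'(3)[OF v]])
      also have "\<dots> = sup0 \<Omega> (\<lambda>x. c * (F (x, True) + v x)) + sup0 \<Omega> (\<lambda>x. c * (F (x, False) - v x))"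
        by (simp add: algebra_simps)
      also have "\<dots> \<le> c * sup0 \<Omega> (\<lambda>x. F (x, True) + v x) + c * sup0 \<Omega> (\<lambda>x. F (x, False) - v x)"
        by (intro add_mono sup0_scale in_C0 F v c)
      finally show "inverse c * split_dist \<Omega> V (\<lambda>z. c * F z) \<le> ?s F v"
        using c by (simp add: field_simps)
    qed
    then show "split_dist \<Omega> V (\<lambda>z. c * F z) \<le> c * split_dist \<Omega> V F"
      using c by (simp add: field_simps)
  qed
qed

theorem C0_dense_if_no_annihilator:
  fixes \<Omega> :: "'a::euclidean_space set"
  assumes V: "function_subspace V" "V \<subseteq> C0 \<Omega>"
    and annihilator: "\<forall>\<mu>. signed_measure (restrict_space borel \<Omega>) \<mu> \<longrightarrow>
       (\<forall>v\<in>V. signed_integral (restrict_space borel \<Omega>) \<mu> v = 0) \<longrightarrow>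
       (\<forall>A\<in>sets (restrict_space borel \<Omega>). \<mu> A = 0)"
    and g: "g \<in> C0 \<Omega>" and \<eta>: "0 < \<eta>"
  obtains v where "v \<in> V" "\<And>x. x \<in> \<Omega> \<Longrightarrow> \<bar>g x - v x\<bar> \<le> \<eta>"
proof (rule ccontr)
  assume "\<not> thesis"
  then have far: "\<exists>x\<in>\<Omega>. \<eta> < \<bar>g x - v x\<bar>" if "v \<in> V" for v
    using \<open>\<And>v. v \<in> V \<Longrightarrow> (\<And>x. x \<in> \<Omega> \<Longrightarrow> \<bar>g x - v x\<bar> \<le> \<eta>) \<Longrightarrow> thesis\<close>[OF that] by (meson not_le)
  note V' = function_subspaceD[OF V(1)] and E = function_subspaceD[OF function_subspace_pairs_C0]
  have pair_in: "pairing f h \<in> pairs_C0 \<Omega>" if "f \<in> C0 \<Omega>" "h \<in> C0 \<Omega>" for f h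
    using that by (simp add: pairs_C0_def)
  have ng: "(\<lambda>x. - g x) \<in> C0 \<Omega>" by (rule C0_minus[OF g])
  obtain L where L: "linear_functional_on (pairs_C0 \<Omega>) L"
    and L_le: "\<And>F. F \<in> pairs_C0 \<Omega> \<Longrightarrow> L F \<le> split_dist \<Omega> V F"
    and Lg: "L (pairing g (\<lambda>x. - g x)) = split_dist \<Omega> V (pairing g (\<lambda>x. - g x))"
    by (rule hahn_banach_dominated[OF function_subspace_pairs_C0 sublinear_split_dist[OF V] pair_in[OF g ng]]) (rule that)
  have L_add: "L (pairing (\<lambda>x. f x + f' x) (\<lambda>x. h x + h' x)) = L (pairing f h) + L (pairing f' h')"
    if "f \<in> C0 \<Omega>" "f' \<in> C0 \<Omega>" "h \<in> C0 \<Omega>" "h' \<in> C0 \<Omega>" for f f' h h'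
    using L pair_in that by (simp add: linear_functional_on_def flip: pairing_add)
  have L_scale: "L (pairing (\<lambda>x. c * f x) (\<lambda>x. c * h x)) = c * L (pairing f h)"
    if "f \<in> C0 \<Omega>" "h \<in> C0 \<Omega>" for c f h
    using L pair_in that by (simp add: linear_functional_on_def flip: pairing_scale)
  have L_bound: "L (pairing f h) \<le> sup0 \<Omega> (\<lambda>x. f x + v x) + sup0 \<Omega> (\<lambda>x. h x - v x)"
    if "f \<in> C0 \<Omega>" "h \<in> C0 \<Omega>" "v \<in> V" for f h v
    using L_le[OF pair_in[OF that(1,2)]] split_dist_le[OF V(2) pair_in[OF that(1,2)] that(3)] by simp
  have sup0_zero: "sup0 \<Omega> (\<lambda>x. 0) = 0"
    using sup0_least[of 0 \<Omega> "\<lambda>x. 0"] sup0_upper(1)[OF C0_zero, of \<Omega>] by simp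
  define L1 where "L1 f = L (pairing f (\<lambda>x. 0))" for f
  define L2 where "L2 f = L (pairing (\<lambda>x. 0) f)" for f
  have L1_le: "L1 f \<le> sup0 \<Omega> f" and L2_le: "L2 f \<le> sup0 \<Omega> f" if "f \<in> C0 \<Omega>" for f
    using L_bound[OF that C0_zero V'(1)] L_bound[OF C0_zero that V'(1)]
    by (simp_all add: L1_def L2_def sup0_zero)
  have lin1: "linear_functional_on (C0 \<Omega>) L1" and lin2: "linear_functional_on (C0 \<Omega>) L2"
    using L_add[OF _ _ C0_zero C0_zero] L_add[OF C0_zero C0_zero] L_scale[OF _ C0_zero] L_scale[OF C0_zero]
    by (simp_all add: linear_functional_on_def L1_def L2_def)
  have positive: "positive_C0_functional \<Omega> K"
    if K: "linear_functional_on (C0 \<Omega>) K" "\<And>f. f \<in> C0 \<Omega> \<Longrightarrow> K f \<le> sup0 \<Omega> f" for K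
  proof (unfold_locales, rule K(1))
    fix f assume f: "f \<in> C0 \<Omega>" "\<And>x. x \<in> \<Omega> \<Longrightarrow> 0 \<le> f x"
    have "K (\<lambda>x. - 1 * f x) \<le> sup0 \<Omega> (\<lambda>x. - 1 * f x)"
      by (intro K(2) C0_scale f(1))
    also have "\<dots> \<le> 0" using f(2) by (intro sup0_least) auto
    also have "K (\<lambda>x. - 1 * f x) = - 1 * K f"
      using K(1) f(1) by (simp only: linear_functional_on_def)
    finally show "0 \<le> K f" by simp
  next
    fix f assume f: "f \<in> C0 \<Omega>" "\<And>x. x \<in> \<Omega> \<Longrightarrow> f x \<le> 1"
    show "K f \<le> 1" using K(2)[OF f(1)] sup0_least[of 1 \<Omega> f] f(2) by force
  qed
  interpret R1: positive_C0_functional \<Omega> L1 by (rule positive[OF lin1 L1_le])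
  interpret R2: positive_C0_functional \<Omega> L2 by (rule positive[OF lin2 L2_le])
  let ?B = "restrict_space borel \<Omega>"
  define \<mu> where "\<mu> A = measure R1.riesz_measure A - measure R2.riesz_measure A" for A
  note M1 = R1.finite_measure_riesz R1.sets_riesz_measure
  note M2 = R2.finite_measure_riesz R2.sets_riesz_measure
  have diff: "L1 f - L2 f = L (pairing f (\<lambda>x. - f x))" if f: "f \<in> C0 \<Omega>" for f
    using L_add[OF f C0_zero C0_zero C0_minus[OF f]] R2.L_scale[OF f, of "-1"]
    by (simp add: L1_def L2_def)
  have L1_eq_L2: "L1 v = L2 v" if v: "v \<in> V" for v
  proof (rule antisym)
    have vC0: "v \<in> C0 \<Omega>" using v V(2) by auto
    have "L (pairing v (\<lambda>x. - v x)) \<le> 0"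
      using L_bound[OF vC0 C0_minus[OF vC0] V'(4)[OF v]] by (simp add: sup0_zero)
    then show "L1 v \<le> L2 v" using diff[OF vC0] by simp
    have "L (pairing (\<lambda>x. - v x) v) \<le> 0"
      using L_bound[OF C0_minus[OF vC0] vC0 v] by (simp add: sup0_zero)
    then have "L1 (\<lambda>x. - v x) \<le> L2 (\<lambda>x. - v x)"
      using diff[OF C0_minus[OF vC0]] by simp
    then show "L2 v \<le> L1 v"
      using R1.L_scale[OF vC0, of "- 1"] R2.L_scale[OF vC0, of "- 1"] by simp
  qed
  have "\<mu> A = 0" if "A \<in> sets ?B" for A
  proof (rule annihilator[rule_format, OF _ _ that])
    show "signed_measure ?B \<mu>"
      unfolding \<mu>_def by (rule signed_measure_measure_diff[OF M1 M2])
    fix v assume v: "v \<in> V"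
    then have vC0: "v \<in> C0 \<Omega>" using V(2) by auto
    obtain C where "\<And>x. x \<in> \<Omega> \<Longrightarrow> \<bar>v x\<bar> \<le> C" using C0_bounded[OF vC0] by metis
    then have "signed_integral ?B \<mu> v = (LINT x|R1.riesz_measure. v x) - (LINT x|R2.riesz_measure. v x)"
      unfolding \<mu>_def
      using borel_measurable_continuous_on_restrict[OF C0_continuous_on[OF vC0]]
      by (intro signed_integral_measure_diff[OF M1 M2, where C = C]) (auto simp: space_restrict_space)
    then show "signed_integral ?B \<mu> v = 0"
      using R1.L_eq_integral[OF vC0] R2.L_eq_integral[OF vC0] L1_eq_L2[OF v] by simp
  qed
  then have "R1.riesz_measure = R2.riesz_measure"
    using M1 M2 by (intro measure_eqI) (auto simp: \<mu>_def finite_measure.emeasure_eq_measure)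
  then have "L1 g = L2 g"
    using R1.L_eq_integral[OF g] R2.L_eq_integral[OF g] by simp
  moreover have "\<eta> \<le> split_dist \<Omega> V (pairing g (\<lambda>x. - g x))"
    unfolding split_dist_def
  proof (rule cINF_greatest)
    show "V \<noteq> {}" using V'(1) by auto
    fix v assume v: "v \<in> V"
    have C: "(\<lambda>x. g x + v x) \<in> C0 \<Omega>" "(\<lambda>x. - g x - v x) \<in> C0 \<Omega>"
      using v V(2) by (auto intro!: C0_add C0_diff C0_minus g)
    obtain x where "x \<in> \<Omega>" "\<eta> < \<bar>g x + v x\<bar>" using far[OF V'(4)[OF v]] by auto
    then have "\<eta> \<le> sup0 \<Omega> (\<lambda>x. g x + v x) + sup0 \<Omega> (\<lambda>x. - g x - v x)"
      using sup0_upper[OF C(1)] sup0_upper[OF C(2)] by (smt (verit))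
    then show "\<eta> \<le> sup0 \<Omega> (\<lambda>x. pairing g (\<lambda>x. - g x) (x, True) + v x)
        + sup0 \<Omega> (\<lambda>x. pairing g (\<lambda>x. - g x) (x, False) - v x)" by simp
  qed
  ultimately show False using diff[OF g] Lg \<eta> by simp
qed

section \<open>Density of the reproducing kernel Hilbert space\<close>

lemma signed_integral_cong:
  assumes "\<And>x. x \<in> space M \<Longrightarrow> f x = g x"
  shows "signed_integral M \<mu> f = signed_integral M \<mu> g"
  using assms
  by (auto simp: signed_integral_def pos_variation_def space_measure_of_conv
      intro!: arg_cong2[where f = "(-)"] Bochner_Integration.integral_cong)

lemma signed_integral_zero: "signed_integral M \<mu> (\<lambda>x. 0) = 0"
  by (simp add: signed_integral_def)

text \<open>
  The intersection \<open>H \<inter> C\<^sub>0(\<Omega>)\<close> contains all kernel sections, so for a measure that annihilates it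
  the inner integral in the definition of strict positive definiteness vanishes identically.
\<close>

lemma rkhs_dense_in_C0:
  fixes \<Omega> :: "'a::euclidean_space set"
  assumes sym: "pos_def_kernel \<Omega> k" and H: "is_rkhs \<Omega> k H ip"
    and k: "\<forall>x\<in>\<Omega>. k x \<in> C0 \<Omega>" and pd: "integrally_strictly_pd \<Omega> k"
    and g: "g \<in> C0 \<Omega>" and \<eta>: "0 < \<eta>"
  obtains h where "h \<in> H" "h \<in> C0 \<Omega>" "\<And>x. x \<in> \<Omega> \<Longrightarrow> \<bar>g x - h x\<bar> \<le> \<eta>"
proof -
  let ?B = "restrict_space borel \<Omega>"
  define V where "V = H \<inter> C0 \<Omega>"
  have V: "function_subspace V"
    using H
    by (auto simp: is_rkhs_def hilbert_function_space_def function_subspace_def V_def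
        intro: C0_zero C0_add C0_scale)
  have "\<mu> A = 0"
    if \<mu>: "signed_measure ?B \<mu>" and zero: "\<And>v. v \<in> V \<Longrightarrow> signed_integral ?B \<mu> v = 0"
      and A: "A \<in> sets ?B" for \<mu> A
  proof (rule ccontr)
    assume "\<mu> A \<noteq> 0"
    then have "signed_integral ?B \<mu> (\<lambda>y. signed_integral ?B \<mu> (\<lambda>x. k x y)) > 0"
      using pd \<mu> A unfolding integrally_strictly_pd_def Let_def by blast
    moreover have "signed_integral ?B \<mu> (\<lambda>x. k x y) = 0" if y: "y \<in> space ?B" for y
    proof -
      have y': "y \<in> \<Omega>" using y by (simp add: space_restrict_space)
      have "k x y = kernel_section \<Omega> k y x" if "x \<in> space ?B" for x
        using that y' sym by (auto simp: pos_def_kernel_def kernel_section_def space_restrict_space)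
      then have "signed_integral ?B \<mu> (\<lambda>x. k x y) = signed_integral ?B \<mu> (kernel_section \<Omega> k y)"
        by (rule signed_integral_cong)
      also have "kernel_section \<Omega> k y \<in> C0 \<Omega>"
        using k y' by (auto simp: kernel_section_def intro: C0_cong[of "k y"])
      then have "kernel_section \<Omega> k y \<in> V"
        using H y' by (simp add: V_def is_rkhs_def)
      then have "signed_integral ?B \<mu> (kernel_section \<Omega> k y) = 0" by (rule zero)
      finally show ?thesis .
    qed
    ultimately show False
      using signed_integral_cong[of ?B "\<lambda>y. signed_integral ?B \<mu> (\<lambda>x. k x y)" "\<lambda>y. 0" \<mu>]
      by (simp add: signed_integral_zero)
  qed
  then have "\<forall>\<mu>. signed_measure ?B \<mu> \<longrightarrow> (\<forall>v\<in>V. signed_integral ?B \<mu> v = 0) \<longrightarrow> (\<forall>A\<in>sets ?B. \<mu> A = 0)"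
    by blast
  moreover have "V \<subseteq> C0 \<Omega>" by (simp add: V_def)
  ultimately show ?thesis
    using C0_dense_if_no_annihilator[OF V _ _ g \<eta>] that unfolding V_def by (metis IntD1 IntD2)
qed

section \<open>Uniform approximation by the exponential family\<close>

lemma abs_ln_diff_le:
  fixes a b \<delta> :: real
  assumes "0 \<le> a" "0 \<le> b" "0 < \<delta>"
  shows "\<bar>ln (a + \<delta>) - ln (b + \<delta>)\<bar> \<le> \<bar>a - b\<bar> / \<delta>"
proof -
  have *: "ln (a + \<delta>) - ln (b + \<delta>) \<le> \<bar>a - b\<bar> / \<delta>" if "0 \<le> a" "0 \<le> b" for a b
  proof -
    have "ln (a + \<delta>) - ln (b + \<delta>) \<le> ((a + \<delta>) - (b + \<delta>)) / (b + \<delta>)"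
      using that assms(3) by (intro ln_diff_le) auto
    also have "\<dots> \<le> \<bar>a - b\<bar> / \<delta>"
      using that assms(3) by (intro frac_le) auto
    finally show ?thesis .
  qed
  show ?thesis using *[OF assms(1,2)] *[OF assms(2,1)] by (simp add: abs_le_iff abs_minus_commute)
qed

text \<open>
  For \<open>l \<ge> 0\<close> the reason is that \<open>log (\<cdot> + \<delta>)\<close> is Lipschitz on the nonnegative reals. A negative \<open>l\<close>
  is possible only if \<open>\<Omega>\<close> is compact, because then \<open>p / q\<^sub>0 - l \<ge> - l > 0\<close> everywhere; in that case the
  subtracted constant is irrelevant, and \<open>max l 0\<close> merely keeps the logarithm meaningful.
\<close>

lemma shifted_log_ratio_in_C0:
  assumes q0: "continuous_on \<Omega> q0" "\<And>x. x \<in> \<Omega> \<Longrightarrow> 0 < q0 x"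
    and p: "p \<in> target_class \<Omega> q0 l" and \<delta>: "0 < \<delta>"
  shows "(\<lambda>x. ln (p x / q0 x + \<delta>) - ln (max l 0 + \<delta>)) \<in> C0 \<Omega>"
proof (rule C0I)
  have p': "continuous_on \<Omega> p" "\<And>x. x \<in> \<Omega> \<Longrightarrow> 0 \<le> p x" "(\<lambda>x. p x / q0 x - l) \<in> C0 \<Omega>"
    using p by (auto simp: target_class_def)
  have ratio: "0 \<le> p x / q0 x" if "x \<in> \<Omega>" for x using p'(2)[OF that] q0(2)[OF that] by simp
  then have pos: "p x / q0 x + \<delta> \<noteq> 0" if "x \<in> \<Omega>" for x using that \<delta> by (smt (verit))
  show "continuous_on \<Omega> (\<lambda>x. ln (p x / q0 x + \<delta>) - ln (max l 0 + \<delta>))"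
    using q0 p'(1) pos by (intro continuous_intros) (auto dest!: q0(2))
  fix \<epsilon> :: real assume \<epsilon>: "0 < \<epsilon>"
  show "\<exists>K. compact K \<and> K \<subseteq> \<Omega> \<and> (\<forall>x\<in>\<Omega> - K. \<bar>ln (p x / q0 x + \<delta>) - ln (max l 0 + \<delta>)\<bar> < \<epsilon>)"
  proof (cases "0 \<le> l")
    case True
    let ?K = "{x \<in> \<Omega>. \<bar>p x / q0 x - l\<bar> \<ge> \<delta> * \<epsilon>}"
    have "compact ?K" using C0_compact[OF p'(3)] \<delta> \<epsilon> by simp
    moreover have "\<bar>ln (p x / q0 x + \<delta>) - ln (max l 0 + \<delta>)\<bar> < \<epsilon>" if x: "x \<in> \<Omega> - ?K" for x
    proof -
      have "\<bar>ln (p x / q0 x + \<delta>) - ln (l + \<delta>)\<bar> \<le> \<bar>p x / q0 x - l\<bar> / \<delta>"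
        using ratio x True \<delta> by (intro abs_ln_diff_le) auto
      also have "\<dots> < \<epsilon>" using x \<delta> by (auto simp: field_simps)
      finally show ?thesis using True by simp
    qed
    moreover have "?K \<subseteq> \<Omega>" by auto
    ultimately show ?thesis by blast
  next
    case False
    then have "\<Omega> = {x \<in> \<Omega>. \<bar>p x / q0 x - l\<bar> \<ge> - l}" using ratio by force
    then have "compact \<Omega>" using C0_compact[OF p'(3), of "- l"] False by simp
    then show ?thesis by auto
  qed
qed

lemma target_class_ratio_bounded:
  assumes "\<And>x. x \<in> \<Omega> \<Longrightarrow> 0 < q0 x" and p: "p \<in> target_class \<Omega> q0 l"
  obtains C where "0 \<le> C" "\<And>x. x \<in> \<Omega> \<Longrightarrow> p x \<le> C * q0 x"
proof -
  obtain B where B: "0 < B" "\<And>x. x \<in> \<Omega> \<Longrightarrow> \<bar>p x / q0 x - l\<bar> \<le> B"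
    using C0_bounded[of "\<lambda>x. p x / q0 x - l" \<Omega>] p unfolding target_class_def by blast
  have "p x \<le> (\<bar>l\<bar> + B) * q0 x" if "x \<in> \<Omega>" for x
  proof -
    have "p x / q0 x \<le> \<bar>l\<bar> + B" using B(2)[OF that] by linarith
    then show ?thesis using assms(1)[OF that] by (simp add: field_simps)
  qed
  then show ?thesis using B(1) by (intro that[of "\<bar>l\<bar> + B"]) auto
qed

text \<open>
  The parameter \<open>h\<close> is chosen within \<open>log s\<close> of \<open>g\<close>, where \<open>s\<^sup>2 = 1 + \<tau>\<close>: one factor \<open>s\<close> is lost in
  comparing \<open>u = exp h q\<^sub>0\<close> with \<open>w = exp g q\<^sub>0\<close> and another one in comparing their integrals, so
  \<open>q = u / Z\<close> and \<open>p\<^sub>\<tau> = w / z\<close> agree up to the factor \<open>1 + \<tau>\<close>. With \<open>p \<le> C q\<^sub>0\<close>, passing from \<open>p\<close> to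
  \<open>p\<^sub>\<tau>\<close> and from \<open>p\<^sub>\<tau>\<close> to \<open>q\<close> costs \<open>\<tau> (C + 1) q\<^sub>0\<close> each, which explains the choice of \<open>\<tau>\<close>.
\<close>

lemma exp_family_uniform_approximation:
  fixes \<Omega> :: "'a::euclidean_space set"
  assumes \<Omega>: "\<Omega> \<in> sets lebesgue"
    and q0': "continuous_on \<Omega> q0" "\<forall>x\<in>\<Omega>. 0 < q0 x"
      "integrable (lebesgue_on \<Omega>) q0" "(LINT x|lebesgue_on \<Omega>. q0 x) = 1"
    and dense: "\<forall>g\<in>C0 \<Omega>. \<forall>\<eta>>0. \<exists>h\<in>H. h \<in> C0 \<Omega> \<and> (\<forall>x\<in>\<Omega>. \<bar>g x - h x\<bar> \<le> \<eta>)"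
    and p: "p \<in> target_class \<Omega> q0 l" and \<theta>: "0 < \<theta>"
  obtains q where "q \<in> exp_family \<Omega> q0 H" "continuous_on \<Omega> q"
    "\<And>x. x \<in> \<Omega> \<Longrightarrow> 0 < q x"
    "\<And>x. x \<in> \<Omega> \<Longrightarrow> \<bar>p x - q x\<bar> \<le> \<theta> * q0 x"
    "\<And>x. x \<in> \<Omega> \<Longrightarrow> ln (p x / q x) \<le> \<theta>"
proof -
  have q0: "continuous_on \<Omega> q0" "\<And>x. x \<in> \<Omega> \<Longrightarrow> 0 < q0 x"
    "integrable (lebesgue_on \<Omega>) q0" "(LINT x|lebesgue_on \<Omega>. q0 x) = 1"
    using q0' by auto
  have p': "continuous_on \<Omega> p" "\<And>x. x \<in> \<Omega> \<Longrightarrow> 0 \<le> p x"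
    "integrable (lebesgue_on \<Omega>) p" "(LINT x|lebesgue_on \<Omega>. p x) = 1"
    using p by (auto simp: target_class_def)
  obtain C where C: "0 \<le> C" "\<And>x. x \<in> \<Omega> \<Longrightarrow> p x \<le> C * q0 x"
    using target_class_ratio_bounded[OF q0(2) p] by metis
  define \<tau> where "\<tau> = \<theta> / (2 * (C + 1))"
  have \<tau>: "0 < \<tau>" "2 * \<tau> * (C + 1) = \<theta>" using \<theta> C(1) by (auto simp: \<tau>_def field_simps)
  have \<tau>\<theta>: "2 * \<tau> \<le> \<theta>" using \<tau> C(1) by (simp add: algebra_simps flip: \<tau>(2))
  define s where "s = sqrt (1 + \<tau>)"
  have s: "1 < s" "s * s = 1 + \<tau>" using \<tau>(1) by (auto simp: s_def)
  define c where "c = ln (max l 0 + \<tau>)"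
  define g where "g x = ln (p x / q0 x + \<tau>) - c" for x
  define w where "w x = exp (- c) * (p x + \<tau> * q0 x)" for x
  have "g \<in> C0 \<Omega>"
    unfolding g_def c_def by (rule shifted_log_ratio_in_C0[OF q0(1,2) p \<tau>(1)])
  then obtain h where h: "h \<in> H" "h \<in> C0 \<Omega>" "\<And>x. x \<in> \<Omega> \<Longrightarrow> \<bar>g x - h x\<bar> \<le> ln s"
    using bspec[OF dense, of g] s(1) by (metis ln_gt_zero)
  have exp_g: "exp (g x) * q0 x = w x" if x: "x \<in> \<Omega>" for x
  proof -
    have "0 < p x / q0 x + \<tau>" using p'(2)[OF x] q0(2)[OF x] \<tau>(1) by (simp add: add_nonneg_pos)
    then have "exp (g x) = exp (- c) * (p x / q0 x + \<tau>)"
      by (simp add: g_def exp_diff exp_minus field_simps)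
    then show ?thesis using q0(2)[OF x] by (simp add: w_def field_simps)
  qed
  have w_pos: "0 < w x" if x: "x \<in> \<Omega>" for x
    using p'(2)[OF x] q0(2)[OF x] \<tau>(1) by (simp add: w_def add_nonneg_pos)
  define u where "u x = exp (h x) * q0 x" for x
  have u_le: "u x \<le> s * w x" and w_le: "w x \<le> s * u x" if x: "x \<in> \<Omega>" for x
  proof -
    have "exp (h x) \<le> exp (g x + ln s)" "exp (g x) \<le> exp (h x + ln s)"
      using h(3)[OF x] by (auto simp: abs_le_iff)
    then have "exp (h x) \<le> s * exp (g x)" "exp (g x) \<le> s * exp (h x)"
      using s(1) by (simp_all add: exp_add mult.commute)
    then show "u x \<le> s * w x" "w x \<le> s * u x"
      using mult_right_mono[of "exp (h x)" "s * exp (g x)" "q0 x"]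
        mult_right_mono[of "exp (g x)" "s * exp (h x)" "q0 x"] q0(2)[OF x] exp_g[OF x]
      by (simp_all add: u_def mult.assoc)
  qed
  have u_pos: "0 < u x" if "x \<in> \<Omega>" for x using q0(2)[OF that] by (simp add: u_def)
  have w_int: "integrable (lebesgue_on \<Omega>) w"
    unfolding w_def using p'(3) q0(3) by simp
  have w_total: "(LINT x|lebesgue_on \<Omega>. w x) = exp (- c) * (1 + \<tau>)"
    unfolding w_def using p'(3,4) q0(3,4) by simp
  have u_cont: "continuous_on \<Omega> u"
    unfolding u_def by (intro continuous_intros C0_continuous_on h(2) q0(1))
  have u_int: "integrable (lebesgue_on \<Omega>) u"
  proof (rule Bochner_Integration.integrable_bound)
    show "integrable (lebesgue_on \<Omega>) (\<lambda>x. s * w x)" using w_int by simp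
    show "u \<in> borel_measurable (lebesgue_on \<Omega>)"
      by (rule continuous_imp_measurable_on_sets_lebesgue[OF u_cont \<Omega>])
    have "norm (u x) \<le> norm (s * w x)" if "x \<in> \<Omega>" for x
      using u_pos[OF that] u_le[OF that] by simp
    then show "AE x in lebesgue_on \<Omega>. norm (u x) \<le> norm (s * w x)"
      by (intro AE_I2) (simp add: space_restrict_space)
  qed
  define Z where "Z = (LINT x|lebesgue_on \<Omega>. u x)"
  define z where "z = exp (- c) * (1 + \<tau>)"
  have z: "0 < z" using \<tau>(1) by (simp add: z_def)
  have "Z \<le> (LINT x|lebesgue_on \<Omega>. s * w x)"
    unfolding Z_def using u_le w_int u_int
    by (intro integral_mono) (auto simp: space_restrict_space)
  then have Z_le: "Z \<le> s * z" using w_total by (simp add: z_def)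
  have "(LINT x|lebesgue_on \<Omega>. w x) \<le> (LINT x|lebesgue_on \<Omega>. s * u x)"
    using w_le w_int u_int by (intro integral_mono) (auto simp: space_restrict_space)
  then have z_le: "z \<le> s * Z" using w_total by (simp add: z_def Z_def)
  have Z: "0 < Z" using z z_le s(1) by (smt (verit) zero_less_mult_pos)
  define q where "q x = exp (h x - log_partition \<Omega> q0 h) * q0 x" for x
  have q_eq: "q x = u x / Z" for x
    using Z by (simp add: q_def log_partition_def u_def exp_diff flip: Z_def[unfolded u_def])
  define p\<^sub>\<tau> where "p\<^sub>\<tau> x = (p x + \<tau> * q0 x) / (1 + \<tau>)" for x
  have w_z: "w x / z = p\<^sub>\<tau> x" for x by (simp add: w_def z_def p\<^sub>\<tau>_def)
  have q_le: "q x \<le> (1 + \<tau>) * p\<^sub>\<tau> x" if x: "x \<in> \<Omega>" for x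
  proof -
    have "u x * z \<le> (s * w x) * (s * Z)"
      using u_le[OF x] z_le u_pos[OF x] z w_pos[OF x] s(1) by (intro mult_mono) auto
    also have "\<dots> = (1 + \<tau>) * w x * Z" unfolding s(2)[symmetric] by (simp only: ac_simps)
    finally have "u x / Z \<le> (1 + \<tau>) * (w x / z)" using z Z by (simp add: field_simps)
    then show ?thesis by (simp only: q_eq w_z)
  qed
  have le_q: "p\<^sub>\<tau> x \<le> (1 + \<tau>) * q x" if x: "x \<in> \<Omega>" for x
  proof -
    have "w x * Z \<le> (s * u x) * (s * z)"
      using w_le[OF x] Z_le u_pos[OF x] Z w_pos[OF x] s(1) by (intro mult_mono) auto
    also have "\<dots> = (1 + \<tau>) * u x * z" unfolding s(2)[symmetric] by (simp only: ac_simps)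
    finally have "w x / z \<le> (1 + \<tau>) * (u x / Z)" using z Z by (simp add: field_simps)
    then show ?thesis by (simp only: q_eq w_z)
  qed
  have q_pos: "0 < q x" if "x \<in> \<Omega>" for x using u_pos[OF that] Z by (simp add: q_eq)
  show ?thesis
  proof
    show "q \<in> exp_family \<Omega> q0 H"
      unfolding exp_family_def natural_params_def
      using h(1) u_int[unfolded u_def[abs_def]]
      by (auto simp: q_def fun_eq_iff intro!: image_eqI[where x = h])
    show "continuous_on \<Omega> q" unfolding q_eq using Z by (intro continuous_intros u_cont) auto
  next
    fix x assume x: "x \<in> \<Omega>"
    show "0 < q x" by (rule q_pos[OF x])
    have p\<tau>: "p\<^sub>\<tau> x \<le> (C + 1) * q0 x"
    proof -
      have "p\<^sub>\<tau> x \<le> (C * q0 x + \<tau> * q0 x) / (1 + \<tau>)"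
        unfolding p\<^sub>\<tau>_def using C(2)[OF x] \<tau>(1) by (intro divide_right_mono) auto
      also have "\<dots> \<le> (C + 1) * q0 x"
      proof -
        have "(C + \<tau>) * q0 x \<le> ((C + 1) * (1 + \<tau>)) * q0 x"
          using C(1) \<tau>(1) q0(2)[OF x] by (intro mult_right_mono) (auto simp: algebra_simps)
        then show ?thesis using \<tau>(1) by (simp add: field_simps)
      qed
      finally show ?thesis .
    qed
    have "\<bar>p x - p\<^sub>\<tau> x\<bar> \<le> \<tau> * ((C + 1) * q0 x)"
    proof -
      have "p x - p\<^sub>\<tau> x = \<tau> * (p x - q0 x) / (1 + \<tau>)"
        using \<tau>(1) by (simp add: p\<^sub>\<tau>_def field_simps)
      then have "\<bar>p x - p\<^sub>\<tau> x\<bar> = \<tau> * \<bar>p x - q0 x\<bar> / (1 + \<tau>)"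
        using \<tau>(1) by (simp add: abs_mult)
      also have "\<dots> \<le> \<tau> * \<bar>p x - q0 x\<bar>"
        using \<tau>(1) by (simp add: field_simps)
      also have "\<bar>p x - q0 x\<bar> \<le> (C + 1) * q0 x"
        using C(2)[OF x] p'(2)[OF x] q0(2)[OF x] C(1) mult_nonneg_nonneg[of C "q0 x"]
        by (simp add: algebra_simps abs_le_iff)
      finally show ?thesis using \<tau>(1) by simp
    qed
    moreover have "\<bar>p\<^sub>\<tau> x - q x\<bar> \<le> \<tau> * p\<^sub>\<tau> x"
    proof -
      have "0 \<le> \<tau> * \<tau> * p\<^sub>\<tau> x"
        using p'(2)[OF x] q0(2)[OF x] \<tau>(1) by (simp add: p\<^sub>\<tau>_def)
      then have "(1 + \<tau>) * ((1 - \<tau>) * p\<^sub>\<tau> x) \<le> p\<^sub>\<tau> x"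
        by (simp add: algebra_simps)
      also have "\<dots> \<le> (1 + \<tau>) * q x" by (rule le_q[OF x])
      finally have "(1 - \<tau>) * p\<^sub>\<tau> x \<le> q x" using \<tau>(1) by simp
      then show ?thesis using q_le[OF x] by (simp add: abs_le_iff algebra_simps)
    qed
    moreover have "\<tau> * p\<^sub>\<tau> x \<le> \<tau> * ((C + 1) * q0 x)" using p\<tau> \<tau>(1) by simp
    ultimately have "\<bar>p x - q x\<bar> \<le> 2 * \<tau> * (C + 1) * q0 x" by (simp add: algebra_simps)
    then show "\<bar>p x - q x\<bar> \<le> \<theta> * q0 x" by (simp only: \<tau>(2))
    show "ln (p x / q x) \<le> \<theta>"
    proof (cases "p x = 0")
      case True
      then show ?thesis using \<theta> by simp
    next
      case False
      then have px: "0 < p x" using p'(2)[OF x] by simp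
      have "p x \<le> (1 + \<tau>) * p\<^sub>\<tau> x"
        using \<tau>(1) q0(2)[OF x] by (simp add: p\<^sub>\<tau>_def)
      also have "\<dots> \<le> (1 + \<tau>) * ((1 + \<tau>) * q x)"
        using le_q[OF x] \<tau>(1) by (intro mult_left_mono) auto
      finally have "p x / q x \<le> (1 + \<tau>) * (1 + \<tau>)"
        using q_pos[OF x] by (simp add: field_simps)
      then have "ln (p x / q x) \<le> ln ((1 + \<tau>) * (1 + \<tau>))"
        using px q_pos[OF x] \<tau>(1) by (subst ln_le_cancel_iff) auto
      also have "\<dots> = 2 * ln (1 + \<tau>)" using \<tau>(1) by (simp add: ln_mult)
      also have "\<dots> \<le> 2 * \<tau>" using ln_add_one_self_le_self[of \<tau>] \<tau>(1) by simp
      also note \<tau>\<theta>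
      finally show ?thesis .
    qed
  qed
qed

section \<open>From pointwise bounds to distances\<close>

lemma Lr_norm_dominated:
  fixes r \<theta> :: real
  assumes r: "0 < r" and \<theta>: "0 \<le> \<theta>"
    and f: "f \<in> borel_measurable (lebesgue_on \<Omega>)"
    and g: "\<And>x. x \<in> \<Omega> \<Longrightarrow> 0 \<le> g x" "integrable (lebesgue_on \<Omega>) (\<lambda>x. g x powr r)"
    and le: "\<And>x. x \<in> \<Omega> \<Longrightarrow> \<bar>f x\<bar> \<le> \<theta> * g x"
  shows "Lr_norm \<Omega> (ereal r) f \<le> ereal (\<theta> * (LINT x|lebesgue_on \<Omega>. g x powr r) powr (1 / r))"
proof -
  let ?I = "LINT x|lebesgue_on \<Omega>. g x powr r"
  have le': "\<bar>f x\<bar> powr r \<le> \<theta> powr r * g x powr r" if "x \<in> \<Omega>" for x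
    using powr_mono2[OF _ _ le[OF that], of r] r \<theta> g(1)[OF that] by (simp add: powr_mult)
  have int: "integrable (lebesgue_on \<Omega>) (\<lambda>x. \<theta> powr r * g x powr r)" using g(2) by simp
  have fint: "integrable (lebesgue_on \<Omega>) (\<lambda>x. \<bar>f x\<bar> powr r)"
  proof (rule Bochner_Integration.integrable_bound[OF int])
    show "(\<lambda>x. \<bar>f x\<bar> powr r) \<in> borel_measurable (lebesgue_on \<Omega>)" using f by simp
    show "AE x in lebesgue_on \<Omega>. norm (\<bar>f x\<bar> powr r) \<le> norm (\<theta> powr r * g x powr r)"
      using le' by (intro AE_I2) (auto simp: space_restrict_space abs_mult)
  qed
  have "(LINT x|lebesgue_on \<Omega>. \<bar>f x\<bar> powr r) \<le> (LINT x|lebesgue_on \<Omega>. \<theta> powr r * g x powr r)"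
    using le' by (intro integral_mono fint int) (auto simp: space_restrict_space)
  also have "\<dots> = \<theta> powr r * ?I" by simp
  finally have "(LINT x|lebesgue_on \<Omega>. \<bar>f x\<bar> powr r) powr (1 / r) \<le> (\<theta> powr r * ?I) powr (1 / r)"
    using r by (intro powr_mono2) auto
  also have "\<dots> = \<theta> * ?I powr (1 / r)"
    using r \<theta> by (simp add: powr_mult powr_powr)
  finally show ?thesis using fint by (simp add: Lr_norm_def)
qed

text \<open>
  The integrand is at most \<open>\<theta> p\<close>, and it is at least \<open>p - q\<close> because \<open>log t \<le> t - 1\<close>. Together
  the two bounds also make it integrable.
\<close>

lemma KL_div_le:
  assumes \<Omega>: "\<Omega> \<in> sets lebesgue"
    and p: "continuous_on \<Omega> p" "\<And>x. x \<in> \<Omega> \<Longrightarrow> 0 \<le> p x"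
      "integrable (lebesgue_on \<Omega>) p" "(LINT x|lebesgue_on \<Omega>. p x) = 1"
    and q: "continuous_on \<Omega> q" "\<And>x. x \<in> \<Omega> \<Longrightarrow> 0 < q x"
    and g: "integrable (lebesgue_on \<Omega>) g" "\<And>x. x \<in> \<Omega> \<Longrightarrow> \<bar>p x - q x\<bar> \<le> g x"
    and ln_le: "\<And>x. x \<in> \<Omega> \<Longrightarrow> ln (p x / q x) \<le> \<theta>" and \<theta>: "0 \<le> \<theta>"
  shows "KL_div \<Omega> p q \<le> ereal \<theta>"
proof -
  have up: "p x * ln (p x / q x) \<le> \<theta> * p x" if "x \<in> \<Omega>" for x
    using mult_left_mono[OF ln_le[OF that] p(2)[OF that]] by (simp add: mult.commute)
  have low: "p x - q x \<le> p x * ln (p x / q x)" if x: "x \<in> \<Omega>" for x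
  proof (cases "p x = 0")
    case True
    then show ?thesis using q(2)[OF x] by simp
  next
    case False
    then have px: "0 < p x" using p(2)[OF x] by simp
    then have "ln (q x / p x) \<le> q x / p x - 1"
      using q(2)[OF x] by (intro ln_le_minus_one) simp
    then have "p x * ln (q x / p x) \<le> p x * (q x / p x - 1)"
      using px by (intro mult_left_mono) auto
    moreover have "ln (q x / p x) = - ln (p x / q x)"
      using px q(2)[OF x] by (simp add: ln_div)
    moreover have "p x * (q x / p x - 1) = q x - p x" using px by (simp add: field_simps)
    ultimately show ?thesis by simp
  qed
  have [measurable]: "p \<in> borel_measurable (lebesgue_on \<Omega>)" "q \<in> borel_measurable (lebesgue_on \<Omega>)"
    using continuous_imp_measurable_on_sets_lebesgue[OF _ \<Omega>] p(1) q(1) by auto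
  have int: "integrable (lebesgue_on \<Omega>) (\<lambda>x. p x * ln (p x / q x))"
  proof (rule Bochner_Integration.integrable_bound)
    show "integrable (lebesgue_on \<Omega>) (\<lambda>x. \<theta> * p x + g x)" using p(3) g(1) by simp
    show "(\<lambda>x. p x * ln (p x / q x)) \<in> borel_measurable (lebesgue_on \<Omega>)" by measurable
    have "\<bar>p x * ln (p x / q x)\<bar> \<le> \<theta> * p x + g x" if "x \<in> \<Omega>" for x
      using up[OF that] low[OF that] g(2)[OF that] mult_nonneg_nonneg[OF \<theta> p(2)[OF that]]
      by (auto simp: abs_le_iff)
    then show "AE x in lebesgue_on \<Omega>. norm (p x * ln (p x / q x)) \<le> norm (\<theta> * p x + g x)"
      by (intro AE_I2) (force simp: space_restrict_space)
  qed
  have "(LINT x|lebesgue_on \<Omega>. p x * ln (p x / q x)) \<le> (LINT x|lebesgue_on \<Omega>. \<theta> * p x)"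
    using up p(3) by (intro integral_mono int) (auto simp: space_restrict_space)
  then have "(LINT x|lebesgue_on \<Omega>. p x * ln (p x / q x)) \<le> \<theta>" using p(4) by simp
  moreover have "AE x in lebesgue_on \<Omega>. q x = 0 \<longrightarrow> p x = 0"
    using q(2) by (intro AE_I2) (force simp: space_restrict_space)
  ultimately show ?thesis using int by (simp add: KL_div_def)
qed

lemma abs_sqrt_diff_le:
  fixes a b :: real
  assumes "0 \<le> a" "0 \<le> b"
  shows "\<bar>sqrt a - sqrt b\<bar> \<le> sqrt \<bar>a - b\<bar>"
proof (rule real_le_rsqrt)
  \<comment> \<open>The square of the difference is at most the difference of the squares.\<close>
  have "\<bar>sqrt a - sqrt b\<bar> * \<bar>sqrt a - sqrt b\<bar> \<le> \<bar>sqrt a - sqrt b\<bar> * (sqrt a + sqrt b)"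
    using assms by (intro mult_left_mono) (auto simp: abs_le_iff)
  also have "\<dots> = \<bar>(sqrt a - sqrt b) * (sqrt a + sqrt b)\<bar>" using assms by (simp add: abs_mult)
  also have "(sqrt a - sqrt b) * (sqrt a + sqrt b) = a - b" using assms by (simp add: algebra_simps)
  finally show "\<bar>sqrt a - sqrt b\<bar>\<^sup>2 \<le> \<bar>a - b\<bar>" by (simp add: power2_eq_square)
qed

lemma Lr_norm_infinity_dominated:
  assumes f: "f \<in> borel_measurable (lebesgue_on \<Omega>)" and \<theta>: "0 \<le> \<theta>"
    and g: "Lr_norm \<Omega> \<infinity> g = ereal E" and le: "\<And>x. x \<in> \<Omega> \<Longrightarrow> \<bar>f x\<bar> \<le> \<theta> * \<bar>g x\<bar>"
  shows "Lr_norm \<Omega> \<infinity> f \<le> ereal (\<theta> * E)"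
proof -
  let ?M = "lebesgue_on \<Omega>"
  have E: "esssup ?M (\<lambda>x. ennreal \<bar>g x\<bar>) = ennreal E" "0 \<le> E"
    using g by (cases "esssup ?M (\<lambda>x. ennreal \<bar>g x\<bar>)"; auto simp: Lr_norm_def enn2ereal_ennreal)+
  have "AE x in ?M. ennreal \<bar>g x\<bar> \<le> ennreal E"
    using esssup_AE[where M = ?M and f = "\<lambda>x. ennreal \<bar>g x\<bar>"] E(1) by simp
  moreover have "AE x in ?M. \<bar>f x\<bar> \<le> \<theta> * \<bar>g x\<bar>"
    using le by (intro AE_I2) (simp add: space_restrict_space)
  ultimately have "AE x in ?M. ennreal \<bar>f x\<bar> \<le> ennreal (\<theta> * E)"
  proof eventually_elim
    case (elim x)
    then have "\<bar>g x\<bar> \<le> E" using E(2) by (simp add: ennreal_le_iff)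
    then show ?case using elim(2) mult_left_mono[of "\<bar>g x\<bar>" E \<theta>] \<theta> by (intro ennreal_leI) linarith
  qed
  then have "esssup ?M (\<lambda>x. ennreal \<bar>f x\<bar>) \<le> ennreal (\<theta> * E)"
    using f by (intro esssup_I) auto
  then have "enn2ereal (esssup ?M (\<lambda>x. ennreal \<bar>f x\<bar>)) \<le> enn2ereal (ennreal (\<theta> * E))"
    by (simp add: less_eq_ennreal.rep_eq)
  then show ?thesis using E(2) \<theta> by (simp add: Lr_norm_def enn2ereal_ennreal)
qed

section \<open>Density of the exponential family\<close>

theorem corollary2:
  fixes \<Omega> :: "'a::euclidean_space set"
    and q0 :: "'a \<Rightarrow> real"
    and l :: real
    and k :: "'a \<Rightarrow> 'a \<Rightarrow> real"
    and H :: "('a \<Rightarrow> real) set"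
    and ip :: "('a \<Rightarrow> real) \<Rightarrow> ('a \<Rightarrow> real) \<Rightarrow> real"
  assumes "locally compact \<Omega>"
    and "continuous_on \<Omega> q0"
    and "\<forall>x\<in>\<Omega>. q0 x > 0"
    and "integrable (lebesgue_on \<Omega>) q0" and "(LINT x|lebesgue_on \<Omega>. q0 x) = 1"
    and "pos_def_kernel \<Omega> k"
    and "is_rkhs \<Omega> k H ip"
    and "\<forall>x\<in>\<Omega>. k x \<in> C0 \<Omega>"
    and "integrally_strictly_pd \<Omega> k"
  shows "dense_wrt (KL_div \<Omega>) (exp_family \<Omega> q0 H) (target_class \<Omega> q0 l) \<and>
         dense_wrt (tv_dist \<Omega>) (exp_family \<Omega> q0 H) (target_class \<Omega> q0 l) \<and>
         dense_wrt (hellinger_dist \<Omega>) (exp_family \<Omega> q0 H) (target_class \<Omega> q0 l) \<and>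
         (\<forall>r::ereal. 1 < r \<longrightarrow> q0 \<in> Lr_space \<Omega> 1 \<inter> Lr_space \<Omega> r \<longrightarrow>
           dense_wrt (Lr_dist \<Omega> r) (exp_family \<Omega> q0 H) (target_class \<Omega> q0 l))"
proof -
  have \<Omega>: "\<Omega> \<in> sets lebesgue"
    using assms(1) unfolding locally_compact_closed_Int_open by (auto intro: sets.Int)
  have q0_pos: "\<And>x. x \<in> \<Omega> \<Longrightarrow> 0 < q0 x" using assms(3) by blast
  have dense: "\<forall>g\<in>C0 \<Omega>. \<forall>\<eta>>0. \<exists>h\<in>H. h \<in> C0 \<Omega> \<and> (\<forall>x\<in>\<Omega>. \<bar>g x - h x\<bar> \<le> \<eta>)"
    using rkhs_dense_in_C0[OF assms(6-9)] by metis
  have meas: "f \<in> borel_measurable (lebesgue_on \<Omega>)" if "continuous_on \<Omega> f" for f :: "'a \<Rightarrow> real"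
    by (rule continuous_imp_measurable_on_sets_lebesgue[OF that \<Omega>])
  \<comment> \<open>All four distances are controlled by the same pointwise bounds.\<close>
  have denseI: "dense_wrt D (exp_family \<Omega> q0 H) (target_class \<Omega> q0 l)"
    if D: "\<And>\<epsilon>. 0 < \<epsilon> \<Longrightarrow> \<exists>\<theta>>0. \<forall>p q. p \<in> target_class \<Omega> q0 l \<longrightarrow> continuous_on \<Omega> q \<longrightarrow>
      (\<forall>x\<in>\<Omega>. 0 < q x) \<longrightarrow> (\<forall>x\<in>\<Omega>. \<bar>p x - q x\<bar> \<le> \<theta> * q0 x) \<longrightarrow> (\<forall>x\<in>\<Omega>. ln (p x / q x) \<le> \<theta>) \<longrightarrow>
      D p q \<le> ereal \<epsilon>" for D
    unfolding dense_wrt_def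
  proof (intro ballI allI impI)
    fix p \<epsilon> assume p: "p \<in> target_class \<Omega> q0 l" and \<epsilon>: "(0::real) < \<epsilon>"
    obtain \<theta> where \<theta>: "0 < \<theta>" and bound: "\<And>q. continuous_on \<Omega> q \<Longrightarrow> \<forall>x\<in>\<Omega>. 0 < q x \<Longrightarrow>
      \<forall>x\<in>\<Omega>. \<bar>p x - q x\<bar> \<le> \<theta> * q0 x \<Longrightarrow> \<forall>x\<in>\<Omega>. ln (p x / q x) \<le> \<theta> \<Longrightarrow> D p q \<le> ereal \<epsilon>"
      using D[OF \<epsilon>] p by blast
    obtain q where "q \<in> exp_family \<Omega> q0 H" "continuous_on \<Omega> q" "\<And>x. x \<in> \<Omega> \<Longrightarrow> 0 < q x"
      "\<And>x. x \<in> \<Omega> \<Longrightarrow> \<bar>p x - q x\<bar> \<le> \<theta> * q0 x" "\<And>x. x \<in> \<Omega> \<Longrightarrow> ln (p x / q x) \<le> \<theta>"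
      by (rule exp_family_uniform_approximation[OF \<Omega> assms(2-5) dense p \<theta>]) (rule that)
    then show "\<exists>q\<in>exp_family \<Omega> q0 H. D p q \<le> ereal \<epsilon>"
      using bound by blast
  qed
  have pD: "continuous_on \<Omega> p" "\<And>x. x \<in> \<Omega> \<Longrightarrow> 0 \<le> p x"
    "integrable (lebesgue_on \<Omega>) p" "(LINT x|lebesgue_on \<Omega>. p x) = 1"
    if "p \<in> target_class \<Omega> q0 l" for p
    using that by (auto simp: target_class_def)
  have KL: "dense_wrt (KL_div \<Omega>) (exp_family \<Omega> q0 H) (target_class \<Omega> q0 l)"
  proof (rule denseI)
    fix \<epsilon> :: real assume \<epsilon>: "0 < \<epsilon>"
    have "KL_div \<Omega> p q \<le> ereal \<epsilon>"
      if "p \<in> target_class \<Omega> q0 l" "continuous_on \<Omega> q" "\<forall>x\<in>\<Omega>. 0 < q x"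
        "\<forall>x\<in>\<Omega>. \<bar>p x - q x\<bar> \<le> \<epsilon> * q0 x" "\<forall>x\<in>\<Omega>. ln (p x / q x) \<le> \<epsilon>" for p q
      using \<epsilon> pD[OF that(1)] that(2-) assms(4)
      by (intro KL_div_le[OF \<Omega>, where g = "\<lambda>x. \<epsilon> * q0 x"]) auto
    then show "\<exists>\<theta>>0. \<forall>p q. p \<in> target_class \<Omega> q0 l \<longrightarrow> continuous_on \<Omega> q \<longrightarrow>
      (\<forall>x\<in>\<Omega>. 0 < q x) \<longrightarrow> (\<forall>x\<in>\<Omega>. \<bar>p x - q x\<bar> \<le> \<theta> * q0 x) \<longrightarrow> (\<forall>x\<in>\<Omega>. ln (p x / q x) \<le> \<theta>) \<longrightarrow>
      KL_div \<Omega> p q \<le> ereal \<epsilon>"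
      using \<epsilon> by blast
  qed
  have Lr: "dense_wrt (Lr_dist \<Omega> (ereal r)) (exp_family \<Omega> q0 H) (target_class \<Omega> q0 l)"
    if r: "0 < r" and int: "integrable (lebesgue_on \<Omega>) (\<lambda>x. q0 x powr r)" for r :: real
  proof (rule denseI)
    fix \<epsilon> :: real assume \<epsilon>: "0 < \<epsilon>"
    define N where "N = (LINT x|lebesgue_on \<Omega>. q0 x powr r) powr (1 / r)"
    have N: "0 \<le> N" by (simp add: N_def)
    define \<theta> where "\<theta> = \<epsilon> / (N + 1)"
    have \<theta>: "0 < \<theta>" "\<theta> * N \<le> \<epsilon>" using \<epsilon> N by (auto simp: \<theta>_def field_simps)
    have "Lr_dist \<Omega> (ereal r) p q \<le> ereal \<epsilon>"
      if p: "p \<in> target_class \<Omega> q0 l" and q: "continuous_on \<Omega> q"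
        and le: "\<forall>x\<in>\<Omega>. \<bar>p x - q x\<bar> \<le> \<theta> * q0 x" for p q
    proof -
      have "Lr_dist \<Omega> (ereal r) p q \<le> ereal (\<theta> * N)"
        unfolding Lr_dist_def N_def using le \<theta>(1) q0_pos
        by (intro Lr_norm_dominated r int meas continuous_on_diff pD(1)[OF p] q)
          (auto simp: less_imp_le)
      then show ?thesis using \<theta>(2) order_trans by fastforce
    qed
    then show "\<exists>\<theta>>0. \<forall>p q. p \<in> target_class \<Omega> q0 l \<longrightarrow> continuous_on \<Omega> q \<longrightarrow>
      (\<forall>x\<in>\<Omega>. 0 < q x) \<longrightarrow> (\<forall>x\<in>\<Omega>. \<bar>p x - q x\<bar> \<le> \<theta> * q0 x) \<longrightarrow> (\<forall>x\<in>\<Omega>. ln (p x / q x) \<le> \<theta>) \<longrightarrow>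
      Lr_dist \<Omega> (ereal r) p q \<le> ereal \<epsilon>"
      using \<theta>(1) by blast
  qed
  have q0_powr1: "integrable (lebesgue_on \<Omega>) (\<lambda>x. q0 x powr 1)"
    using assms(4) by (rule Bochner_Integration.integrable_cong[THEN iffD1, rotated 2])
      (use q0_pos in \<open>auto simp: space_restrict_space less_imp_le\<close>)
  have TV: "dense_wrt (tv_dist \<Omega>) (exp_family \<Omega> q0 H) (target_class \<Omega> q0 l)"
    using Lr[OF _ q0_powr1] by (simp add: Lr_dist_def tv_dist_def one_ereal_def dense_wrt_def)
  have sqrt_q0: "sqrt (q0 x) powr 2 = q0 x" if "x \<in> \<Omega>" for x
    using q0_pos[OF that] by simp
  have hellinger: "dense_wrt (hellinger_dist \<Omega>) (exp_family \<Omega> q0 H) (target_class \<Omega> q0 l)"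
  proof (rule denseI)
    fix \<epsilon> :: real assume \<epsilon>: "0 < \<epsilon>"
    have total: "(LINT x|lebesgue_on \<Omega>. sqrt (q0 x) powr 2) = 1"
      using assms(5) by (subst Bochner_Integration.integral_cong[OF refl, where g = q0])
        (auto simp: space_restrict_space sqrt_q0)
    have int: "integrable (lebesgue_on \<Omega>) (\<lambda>x. sqrt (q0 x) powr 2)"
      using assms(4) by (subst Bochner_Integration.integrable_cong[OF refl, where g = q0])
        (auto simp: space_restrict_space sqrt_q0)
    have "hellinger_dist \<Omega> p q \<le> ereal \<epsilon>"
      if p: "p \<in> target_class \<Omega> q0 l" and q: "continuous_on \<Omega> q" "\<forall>x\<in>\<Omega>. 0 < q x"
        and le: "\<forall>x\<in>\<Omega>. \<bar>p x - q x\<bar> \<le> \<epsilon>\<^sup>2 * q0 x" for p q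
    proof -
      have "\<bar>sqrt (p x) - sqrt (q x)\<bar> \<le> \<epsilon> * sqrt (q0 x)" if x: "x \<in> \<Omega>" for x
      proof -
        have "\<bar>sqrt (p x) - sqrt (q x)\<bar> \<le> sqrt \<bar>p x - q x\<bar>"
          using pD(2)[OF p x] q(2) x by (intro abs_sqrt_diff_le) (auto simp: less_imp_le)
        also have "\<dots> \<le> sqrt (\<epsilon>\<^sup>2 * q0 x)" using le x by simp
        also have "\<dots> = \<epsilon> * sqrt (q0 x)" using \<epsilon> by (simp add: real_sqrt_mult)
        finally show ?thesis .
      qed
      then have "Lr_norm \<Omega> (ereal 2) (\<lambda>x. sqrt (p x) - sqrt (q x))
          \<le> ereal (\<epsilon> * (LINT x|lebesgue_on \<Omega>. sqrt (q0 x) powr 2) powr (1 / 2))"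
        using \<epsilon> q0_pos
        by (intro Lr_norm_dominated int meas continuous_intros pD(1)[OF p] q(1)) (auto simp: less_imp_le)
      then show ?thesis unfolding hellinger_dist_def total by simp
    qed
    then show "\<exists>\<theta>>0. \<forall>p q. p \<in> target_class \<Omega> q0 l \<longrightarrow> continuous_on \<Omega> q \<longrightarrow>
      (\<forall>x\<in>\<Omega>. 0 < q x) \<longrightarrow> (\<forall>x\<in>\<Omega>. \<bar>p x - q x\<bar> \<le> \<theta> * q0 x) \<longrightarrow> (\<forall>x\<in>\<Omega>. ln (p x / q x) \<le> \<theta>) \<longrightarrow>
      hellinger_dist \<Omega> p q \<le> ereal \<epsilon>"
      using \<epsilon> by (intro exI[of _ "\<epsilon>\<^sup>2"]) auto
  qed
  have "dense_wrt (Lr_dist \<Omega> r) (exp_family \<Omega> q0 H) (target_class \<Omega> q0 l)"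
    if r: "1 < r" and q0_Lr: "q0 \<in> Lr_space \<Omega> r" for r :: ereal
  proof (cases r)
    case (real r')
    have "integrable (lebesgue_on \<Omega>) (\<lambda>x. \<bar>q0 x\<bar> powr r')"
      using q0_Lr real by (auto simp: Lr_space_def Lr_norm_def split: if_splits)
    then have "integrable (lebesgue_on \<Omega>) (\<lambda>x. q0 x powr r')"
      by (rule Bochner_Integration.integrable_cong[THEN iffD1, rotated 2])
        (use q0_pos in \<open>auto simp: space_restrict_space less_imp_le\<close>)
    then show ?thesis using Lr[of r'] r real by (simp add: one_ereal_def)
  next
    case PInf
    obtain E where E: "Lr_norm \<Omega> \<infinity> q0 = ereal E" "0 \<le> E"
    proof -
      have "Lr_norm \<Omega> \<infinity> q0 < \<infinity>" "0 \<le> Lr_norm \<Omega> \<infinity> q0"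
        using q0_Lr PInf by (auto simp: Lr_space_def Lr_norm_def)
      then show ?thesis using that by (cases "Lr_norm \<Omega> \<infinity> q0") auto
    qed
    show ?thesis
      unfolding PInf
    proof (rule denseI)
      fix \<epsilon> :: real assume \<epsilon>: "0 < \<epsilon>"
      define \<theta> where "\<theta> = \<epsilon> / (E + 1)"
      have \<theta>: "0 < \<theta>" "\<theta> * E \<le> \<epsilon>" using \<epsilon> E(2) by (auto simp: \<theta>_def field_simps)
      have "Lr_dist \<Omega> \<infinity> p q \<le> ereal \<epsilon>"
        if p: "p \<in> target_class \<Omega> q0 l" and q: "continuous_on \<Omega> q"
          and le: "\<forall>x\<in>\<Omega>. \<bar>p x - q x\<bar> \<le> \<theta> * q0 x" for p q
      proof -
        have "Lr_dist \<Omega> \<infinity> p q \<le> ereal (\<theta> * E)"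
          unfolding Lr_dist_def using le \<theta>(1) q0_pos
          by (intro Lr_norm_infinity_dominated[OF _ _ E(1)] meas continuous_on_diff pD(1)[OF p] q)
            (auto simp: less_imp_le)
        then show ?thesis using \<theta>(2) order_trans by fastforce
      qed
      then show "\<exists>\<theta>>0. \<forall>p q. p \<in> target_class \<Omega> q0 l \<longrightarrow> continuous_on \<Omega> q \<longrightarrow>
        (\<forall>x\<in>\<Omega>. 0 < q x) \<longrightarrow> (\<forall>x\<in>\<Omega>. \<bar>p x - q x\<bar> \<le> \<theta> * q0 x) \<longrightarrow> (\<forall>x\<in>\<Omega>. ln (p x / q x) \<le> \<theta>) \<longrightarrow>
        Lr_dist \<Omega> \<infinity> p q \<le> ereal \<epsilon>"
        using \<theta>(1) by blast
    qed
  next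
    case MInf
    then show ?thesis using r by simp
  qed
  then show ?thesis using KL TV hellinger by blast
qed

end
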